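(* Let $p\geq 5$ be a prime, let $\lambda$ be a partition of a positive integer, and assume that the corresponding abelian $p$-group $G_{\lambda}$ is noncyclic. Then $$\mathrm{N}(\mathrm{P}(G_{\lambda}))\equiv \binom{2p-1}{p-1} \pmod{p^{4}}.$$
   Context: For a finite group $G$, take independent commuting variables $x_g$ ($g\in G$) and let $M(G):=(x_{gh^{-1}})_{g,h\in G}$ be the group matrix. The group permanent is $\mathrm{P}(G):=\mathrm{perm}(M(G))=\sum_{\sigma}\prod_{g\in G}x_{g\sigma(g)^{-1}}\in\mathbb{Z}[x_g : g\in G]$, where $\sigma$ runs over all permutations of the set $G$. For a polynomial $f$, $\mathrm{N}(f)$ denotes the number of distinct monomials with nonzero coefficient in $f$. For a partition $\lambda=(k_1,\ldots,k_r)$, $k_1\ge\cdots\ge k_r\ge 1$, of a positive integer, the associated abelian $p$-group is $G_{\lambda}:=\mathrm{C}_{p^{k_1}}\times\mathrm{C}_{p^{k_2}}\times\cdots\times\mathrm{C}_{p^{k_r}}$, where $\mathrm{C}_n$ is the cyclic group of order $n$. *)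

theory Defs
  imports
    "HOL-Algebra.Product_Groups"
    "HOL-Library.Poly_Mapping"
    "HOL-Combinatorics.Permutations"
    "HOL-Number_Theory.Cong"
begin

text \<open>
  The ring \<open>\<int>[x\<^sub>g : g \<in> G]\<close>: an exponent vector is a finitely supported map from indeterminates to
  \<open>nat\<close>, and a polynomial is a finitely supported map from exponent vectors to \<open>int\<close>, multiplied by
  convolution. Indeterminates are indexed by the whole type; only those with
  \<open>g \<in> carrier G\<close> occur in the group matrix.
\<close>

type_synonym 'a int_mpoly = "('a \<Rightarrow>\<^sub>0 nat) \<Rightarrow>\<^sub>0 int"

definition indet :: "'a \<Rightarrow> 'a int_mpoly"
  where "indet g = Poly_Mapping.single (Poly_Mapping.single g 1) 1"

definition num_monomials :: "'a int_mpoly \<Rightarrow> nat"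
  where "num_monomials f = card (Poly_Mapping.keys f)"

definition permanent :: "'a set \<Rightarrow> ('a \<Rightarrow> 'a \<Rightarrow> 'r) \<Rightarrow> 'r::comm_semiring_1"
  where "permanent A M = (\<Sum>\<sigma> | \<sigma> permutes A. \<Prod>i\<in>A. M i (\<sigma> i))"

definition group_matrix :: "('a, 'b) monoid_scheme \<Rightarrow> 'a \<Rightarrow> 'a \<Rightarrow> 'a int_mpoly"
  where "group_matrix G g h = indet (g \<otimes>\<^bsub>G\<^esub> inv\<^bsub>G\<^esub> h)"

definition group_permanent :: "('a, 'b) monoid_scheme \<Rightarrow> 'a int_mpoly"
  where "group_permanent G = permanent (carrier G) (group_matrix G)"

definition is_partition :: "nat list \<Rightarrow> nat \<Rightarrow> bool"
  where "is_partition ks n \<longleftrightarrow> sorted_wrt (\<ge>) ks \<and> (\<forall>k\<in>set ks. 1 \<le> k) \<and> sum_list ks = n"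

definition abelian_p_group :: "nat \<Rightarrow> nat list \<Rightarrow> (nat \<Rightarrow> int) monoid"
  where "abelian_p_group p ks =
    product_group {..<length ks} (\<lambda>i. integer_mod_group (p ^ (ks ! i)))"

end

theory Submission
  imports
    Defs
    "HOL-Algebra.Multiplicative_Group"
    "HOL-Computational_Algebra.Polynomial_FPS"
begin

text \<open>
  The coefficients of a permanent of indeterminates are nonnegative, so no monomials cancel, and the
  monomials of the group permanent are the multisets \<open>{g - \<sigma>(g)}\<close>, where \<open>\<sigma>\<close> is a permutation of
  the group \<open>G\<close>. Marshall Hall's theorem (\<open>hall_difference_mset\<close>) says which multisets these are:
  all those of size \<open>|G|\<close> with sum zero. It is proved here by exchanging two elements of a multiset
  at a time. After a change of variable an exchange asks for a permutation whose undirected edges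
  \<open>{x, \<tau> x}\<close> are those of a given one, except that two of them are reconnected; this is the 2-opt
  move on cycles (\<open>two_opt\<close>).

  The zero-sum multisets are then counted with characters. Orthogonality turns \<open>|G|\<close> times their
  number into a sum over the characters \<open>\<chi>\<close> of \<open>G\<close> of the coefficient of \<open>X^|G|\<close> in
  \<open>\<Prod>\<^sub>g 1 / (1 - \<chi>(g) X)\<close>. If \<open>\<chi>\<close> has order \<open>d\<close>, then it takes every \<open>d\<close>-th root of unity equally
  often, this product is \<open>(1 - X^d)^(-|G|/d)\<close>, and the coefficient is \<open>binom(2|G|/d - 1, |G|/d - 1)\<close>
  (\<open>count_one_product_multisets\<close>).

  Let \<open>|G| = p^m\<close>, let \<open>c\<^sub>j\<close> be the binomial coefficient for \<open>|G|/d = p^j\<close>, and let \<open>a\<^sub>i\<close> be the number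
  of characters killed by \<open>p^i\<close>. Summation by parts gives
  \<open>p^m N = p^m + \<Sum>\<^sub>i\<^sub><\<^sub>m a\<^sub>i (c\<^sub>m\<^sub>-\<^sub>i - c\<^sub>m\<^sub>-\<^sub>i\<^sub>-\<^sub>1)\<close>. A sharpening of Wolstenholme's theorem
  (\<open>half_central_prime_power_cong\<close>) makes \<open>c\<^sub>j - c\<^sub>j\<^sub>-\<^sub>1\<close> divisible by \<open>p^(3j)\<close>, and \<open>p^i\<close> divides \<open>a\<^sub>i\<close>.
  Hence the terms with \<open>i \<le> m - 2\<close> are divisible by \<open>p^(i + 3(m - i))\<close>, a multiple of \<open>p^(m + 4)\<close>.
  For noncyclic \<open>G\<close> every character is killed by \<open>p^(m-1)\<close>, so the term \<open>i = m - 1\<close> is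
  \<open>p^m (c\<^sub>1 - 1)\<close>, and dividing by \<open>p^m\<close> leaves \<open>c\<^sub>1\<close> modulo \<open>p^4\<close>.
\<close>

section \<open>Reconnecting two edges of a permutation\<close>

text \<open>
  Here and below a permutation \<open>f\<close> is read as a graph with edges \<open>{x, f x}\<close>, and \<open>h\<close> labels the edges.
  Precomposing with a transposition exchanges the endpoints of two edges.
\<close>
lemma swap_values_mset:
  assumes "finite A" "a \<in> A" "b \<in> A" "a \<noteq> b"
  shows "image_mset (\<lambda>x. h x ((f \<circ> transpose a b) x)) (mset_set A) + {#h a (f a), h b (f b)#}
       = image_mset (\<lambda>x. h x (f x)) (mset_set A) + {#h a (f b), h b (f a)#}"
proof -
  define B where "B = A - {a, b}"
  have "A = insert a (insert b B)" "finite B" "a \<notin> insert b B" "b \<notin> B"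
    using assms by (auto simp: B_def)
  moreover have "image_mset (\<lambda>x. h x ((f \<circ> transpose a b) x)) (mset_set B)
      = image_mset (\<lambda>x. h x (f x)) (mset_set B)"
    by (rule image_mset_cong) (use \<open>finite B\<close> in \<open>auto simp: B_def transpose_def\<close>)
  ultimately show ?thesis using assms by (simp add: o_def)
qed

text \<open>
  A set that \<open>\<tau>\<close> maps onto itself is a union of cycles. Running through them backwards keeps all
  undirected edges, hence all symmetric labels.
\<close>
lemma reverse_cycles_mset:
  assumes fin: "finite A" and tau: "\<tau> permutes A" and OA: "D \<subseteq> A" and inv: "\<tau> ` D = D"
    and sym: "\<And>x y. h x y = h y x"
  defines "\<rho> \<equiv> (\<lambda>x. if x \<in> D then inv_into UNIV \<tau> x else \<tau> x)"
  shows "\<rho> permutes A"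
    and "image_mset (\<lambda>x. h x (\<rho> x)) (mset_set A) = image_mset (\<lambda>x. h x (\<tau> x)) (mset_set A)"
proof -
  have inj: "inj \<tau>" using tau permutes_inj by blast
  have tauO: "bij_betw \<tau> D D" using inj inv by (auto simp: bij_betw_def intro: inj_on_subset)
  have "inv_into UNIV \<tau> x \<in> D" if "x \<in> D" for x
    using that inv inv_f_f[OF inj] by (metis imageE)
  hence "bij_betw (inv_into UNIV \<tau>) D D"
    by (intro bij_betw_byWitness[where f' = \<tau>])
       (use inv permutes_inverses[OF tau] in auto)
  hence 1: "bij_betw \<rho> D D" by (rule bij_betw_cong[THEN iffD1, rotated]) (simp add: \<rho>_def)
  have "\<tau> ` (A - D) = A - D"
    using image_set_diff[OF inj, of A D] inv permutes_image[OF tau] by simp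
  hence "bij_betw \<tau> (A - D) (A - D)" using inj by (auto simp: bij_betw_def intro: inj_on_subset)
  hence 2: "bij_betw \<rho> (A - D) (A - D)"
    by (rule bij_betw_cong[THEN iffD1, rotated]) (simp add: \<rho>_def)
  have "bij_betw \<rho> (D \<union> (A - D)) (D \<union> (A - D))"
    by (rule bij_betw_combine[OF 1 2]) auto
  hence "bij_betw \<rho> A A" using OA by (simp add: Un_absorb1)
  moreover have "\<rho> x = x" if "x \<notin> A" for x
    using that OA tau by (auto simp: \<rho>_def permutes_def)
  ultimately show "\<rho> permutes A" by (intro bij_imp_permutes)
  have finO: "finite D" using OA fin finite_subset by blast
  have split: "mset_set A = mset_set D + mset_set (A - D)"
    using mset_set_Union[of D "A - D"] finO fin OA by (simp add: Un_absorb1)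
  have "image_mset (\<lambda>x. h x (\<rho> x)) (mset_set D)
      = image_mset (\<lambda>x. h x (inv_into UNIV \<tau> x)) (image_mset \<tau> (mset_set D))"
    using tauO finO by (subst image_mset_mset_set) (auto simp: bij_betw_def \<rho>_def inv intro!: image_mset_cong)
  also have "\<dots> = image_mset (\<lambda>x. h x (\<tau> x)) (mset_set D)"
    using permutes_inverses[OF tau] by (simp add: multiset.map_comp o_def sym)
  finally have a: "image_mset (\<lambda>x. h x (\<rho> x)) (mset_set D) = image_mset (\<lambda>x. h x (\<tau> x)) (mset_set D)" .
  have "image_mset (\<lambda>x. h x (\<rho> x)) (mset_set (A - D)) = image_mset (\<lambda>x. h x (\<tau> x)) (mset_set (A - D))"
    by (rule image_mset_cong) (use fin in \<open>auto simp: \<rho>_def\<close>)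
  with a show "image_mset (\<lambda>x. h x (\<rho> x)) (mset_set A) = image_mset (\<lambda>x. h x (\<tau> x)) (mset_set A)"
    by (simp add: split)
qed

text \<open>
  If no cycle contains both \<open>u\<close> and \<open>v\<close>, reversing the cycle of \<open>v\<close> makes \<open>\<tau> v\<close> point to \<open>v\<close>. Exchanging
  the images of \<open>u\<close> and \<open>\<tau> v\<close> then creates the edges \<open>{u, v}\<close> and \<open>{\<tau> u, \<tau> v}\<close>.
\<close>
lemma two_opt_separated:
  assumes fin: "finite A" and tau: "\<tau> permutes A" and OA: "D \<subseteq> A" and inv: "\<tau> ` D = D"
    and sym: "\<And>x y. h x y = h y x" and uv: "u \<in> A" "u \<notin> D" "v \<in> D"
  shows "\<exists>\<tau>'. \<tau>' permutes A \<and>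
     image_mset (\<lambda>x. h x (\<tau>' x)) (mset_set A) + {#h u (\<tau> u), h v (\<tau> v)#}
     = image_mset (\<lambda>x. h x (\<tau> x)) (mset_set A) + {#h u v, h (\<tau> u) (\<tau> v)#}"
proof -
  define \<rho> where "\<rho> = (\<lambda>x. if x \<in> D then inv_into UNIV \<tau> x else \<tau> x)"
  have rev: "\<rho> permutes A"
    "image_mset (\<lambda>x. h x (\<rho> x)) (mset_set A) = image_mset (\<lambda>x. h x (\<tau> x)) (mset_set A)"
    unfolding \<rho>_def by (rule reverse_cycles_mset[OF fin tau OA inv sym])+
  have tv: "\<tau> v \<in> D" using uv inv by blast
  have "\<rho> (\<tau> v) = v" "\<rho> u = \<tau> u"
    using tv uv permutes_inverses[OF tau] by (auto simp: \<rho>_def)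
  moreover have "u \<noteq> \<tau> v" "\<tau> v \<in> A" using tv uv OA by auto
  ultimately have "image_mset (\<lambda>x. h x ((\<rho> \<circ> transpose u (\<tau> v)) x)) (mset_set A) + {#h u (\<tau> u), h (\<tau> v) v#}
       = image_mset (\<lambda>x. h x (\<tau> x)) (mset_set A) + {#h u v, h (\<tau> v) (\<tau> u)#}"
    using swap_values_mset[OF fin uv(1), of "\<tau> v" h \<rho>] rev(2) by simp
  moreover have "(\<rho> \<circ> transpose u (\<tau> v)) permutes A"
    using rev(1) uv(1) \<open>\<tau> v \<in> A\<close> by (intro permutes_compose permutes_swap_id)
  ultimately show ?thesis by (metis sym)
qed

text \<open>
  If \<open>u\<close> and \<open>v\<close> lie on the same cycle, exchanging their images splits it into one cycle through \<open>u\<close> and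
  one through \<open>v\<close>. The edges \<open>{u, v}\<close> and \<open>{\<tau> u, \<tau> v}\<close> to be created are the same for the split
  permutation, so this case reduces to that of separate cycles.
\<close>
lemma two_opt:
  assumes fin: "finite A" and tau: "\<tau> permutes A" and uv: "u \<in> A" "v \<in> A" "u \<noteq> v"
    and sym: "\<And>x y. h x y = h y x"
  shows "\<exists>\<tau>'. \<tau>' permutes A \<and>
     image_mset (\<lambda>x. h x (\<tau>' x)) (mset_set A) + {#h u (\<tau> u), h v (\<tau> v)#}
     = image_mset (\<lambda>x. h x (\<tau> x)) (mset_set A) + {#h u v, h (\<tau> u) (\<tau> v)#}"
proof (cases "\<exists>k. (\<tau> ^^ k) u = v")
  case False
  define C where "C = range (\<lambda>k. (\<tau> ^^ k) u)"
  have inA: "(\<tau> ^^ k) u \<in> A" for k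
    by (induction k) (use uv permutes_in_image[OF tau] in auto)
  hence CA: "C \<subseteq> A" by (auto simp: C_def)
  have "\<tau> ` C \<subseteq> C"
  proof
    fix y assume "y \<in> \<tau> ` C"
    then obtain k where "y = \<tau> ((\<tau> ^^ k) u)" by (auto simp: C_def)
    hence "y = (\<tau> ^^ Suc k) u" by simp
    thus "y \<in> C" unfolding C_def by (rule range_eqI)
  qed
  moreover have inj: "inj \<tau>" using tau permutes_inj by blast
  ultimately have "\<tau> ` C = C"
    using CA fin by (intro endo_inj_surj) (auto intro: finite_subset inj_on_subset)
  hence "\<tau> ` (A - C) = A - C"
    using image_set_diff[OF inj, of A C] permutes_image[OF tau] by simp
  moreover have "u \<in> C" unfolding C_def by (rule range_eqI[of _ _ 0]) simp
  moreover have "v \<notin> C" using False by (auto simp: C_def)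
  ultimately show ?thesis
    using uv by (intro two_opt_separated[OF fin tau, of "A - C"] sym) auto
next
  case True
  define k where "k = (LEAST k. (\<tau> ^^ k) u = v)"
  have k: "(\<tau> ^^ k) u = v" unfolding k_def using True by (rule LeastI_ex)
  have kmin: "(\<tau> ^^ i) u \<noteq> v" if "i < k" for i
    using that not_less_Least unfolding k_def by blast
  have k0: "k > 0" using k uv by (cases k) auto
  have inj: "inj \<tau>" using tau permutes_inj by blast
  have no_u: "(\<tau> ^^ i) u \<noteq> u" if "1 \<le> i" "i \<le> k" for i
  proof
    assume u: "(\<tau> ^^ i) u = u"
    have "(\<tau> ^^ (k - i)) u = (\<tau> ^^ (k - i)) ((\<tau> ^^ i) u)" by (simp add: u)
    also have "\<dots> = (\<tau> ^^ (k - i + i)) u" by (simp only: funpow_add o_def)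
    also have "\<dots> = v" using that k by simp
    finally show False using kmin[of "k - i"] that by simp
  qed
  define \<tau>2 where "\<tau>2 = \<tau> \<circ> transpose u v"
  \<comment> \<open>the cycle of \<open>v\<close> after the split: the arc of the old cycle that starts behind \<open>u\<close> and ends in \<open>v\<close>\<close>
  define C where "C = (\<lambda>i. (\<tau> ^^ i) u) ` {1..k}"
  have tau2: "\<tau>2 permutes A"
    unfolding \<tau>2_def using uv tau by (intro permutes_compose permutes_swap_id)
  have inA: "(\<tau> ^^ k) u \<in> A" for k
    by (induction k) (use uv permutes_in_image[OF tau] in auto)
  hence CA: "C \<subseteq> A" by (auto simp: C_def)
  have "\<tau>2 ` C \<subseteq> C"
  proof
    fix y assume "y \<in> \<tau>2 ` C"
    then obtain i where i: "1 \<le> i" "i \<le> k" "y = \<tau>2 ((\<tau> ^^ i) u)" by (auto simp: C_def)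
    show "y \<in> C"
    proof (cases "i = k")
      case True
      hence "y = (\<tau> ^^ 1) u" using i k by (simp add: \<tau>2_def)
      thus ?thesis unfolding C_def using k0 by (intro image_eqI[of _ _ 1]) auto
    next
      case False
      hence "y = (\<tau> ^^ Suc i) u" using i no_u[of i] kmin[of i] by (simp add: \<tau>2_def transpose_def)
      thus ?thesis unfolding C_def using False i by (intro image_eqI[of _ _ "Suc i"]) auto
    qed
  qed
  moreover have "inj \<tau>2" using tau2 permutes_inj by blast
  ultimately have "\<tau>2 ` C = C"
    using CA fin by (intro endo_inj_surj) (auto intro: finite_subset inj_on_subset)
  moreover have "u \<notin> C" "v \<in> C" using no_u k k0 by (force simp: C_def)+
  ultimately obtain \<tau>' where 1: "\<tau>' permutes A"
     "image_mset (\<lambda>x. h x (\<tau>' x)) (mset_set A) + {#h u (\<tau>2 u), h v (\<tau>2 v)#}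
     = image_mset (\<lambda>x. h x (\<tau>2 x)) (mset_set A) + {#h u v, h (\<tau>2 u) (\<tau>2 v)#}"
    using two_opt_separated[OF fin tau2 CA, of h u v] sym uv by metis
  have 2: "image_mset (\<lambda>x. h x (\<tau>2 x)) (mset_set A) + {#h u (\<tau> u), h v (\<tau> v)#}
       = image_mset (\<lambda>x. h x (\<tau> x)) (mset_set A) + {#h u (\<tau> v), h v (\<tau> u)#}"
    unfolding \<tau>2_def by (rule swap_values_mset[OF fin uv])
  have vals: "\<tau>2 u = \<tau> v" "\<tau>2 v = \<tau> u" by (auto simp: \<tau>2_def)
  define E' E2 E P Q R where "E' = image_mset (\<lambda>x. h x (\<tau>' x)) (mset_set A)"
    and "E2 = image_mset (\<lambda>x. h x (\<tau>2 x)) (mset_set A)"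
    and "E = image_mset (\<lambda>x. h x (\<tau> x)) (mset_set A)"
    and "P = {#h u (\<tau> v), h v (\<tau> u)#}" and "Q = {#h u v, h (\<tau> u) (\<tau> v)#}"
    and "R = {#h u (\<tau> u), h v (\<tau> v)#}"
  have "E' + P = E2 + Q" "E2 + R = E + P"
    using 1(2) 2 by (simp_all add: E'_def E2_def E_def P_def Q_def R_def vals sym[of "\<tau> v" "\<tau> u"])
  hence "(E' + R) + P = (E + Q) + P" by (metis add.assoc add.commute)
  hence "E' + R = E + Q" by simp
  with 1(1) show ?thesis unfolding E'_def E_def Q_def R_def by blast
qed

section \<open>Multisets of differences in a finite abelian group\<close>

text \<open>
  Powers replace a fold over the multiset because the group operation is commutative on the carrier
  only.
\<close>
definition mset_finprod :: "('a, 'b) monoid_scheme \<Rightarrow> 'a multiset \<Rightarrow> 'a"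
  where "mset_finprod G M = (\<Otimes>\<^bsub>G\<^esub>g\<in>carrier G. g [^]\<^bsub>G\<^esub> count M g)"

context comm_group
begin

lemma mset_finprod_closed [simp]: "mset_finprod G M \<in> carrier G"
  by (auto simp: mset_finprod_def intro!: finprod_closed)

lemma mset_finprod_empty [simp]: "mset_finprod G {#} = \<one>"
  by (simp add: mset_finprod_def)

lemma mset_finprod_add_mset:
  assumes "finite (carrier G)" "a \<in> carrier G"
  shows "mset_finprod G (add_mset a M) = a \<otimes> mset_finprod G M"
proof -
  have "mset_finprod G (add_mset a M)
      = (\<Otimes>g\<in>carrier G. (if a = g then g else \<one>) \<otimes> g [^] count M g)"
    unfolding mset_finprod_def
    by (rule finprod_cong') (auto simp flip: nat_pow_Suc2)
  also have "\<dots> = (\<Otimes>g\<in>carrier G. if a = g then g else \<one>) \<otimes> mset_finprod G M"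
    unfolding mset_finprod_def by (rule finprod_multf) auto
  also have "(\<Otimes>g\<in>carrier G. if a = g then g else \<one>) = a"
    using assms by (intro finprod_singleton) auto
  finally show ?thesis .
qed

lemma mset_finprod_image_mset_set:
  assumes "finite (carrier G)" "finite A" "f \<in> A \<rightarrow> carrier G"
  shows "mset_finprod G (image_mset f (mset_set A)) = finprod G f A"
  using assms(2,3)
proof (induction A rule: finite_induct)
  case (insert x F)
  thus ?case using assms(1) by (simp add: mset_finprod_add_mset Pi_def)
qed simp

lemma mset_finprod_differences:
  assumes "finite (carrier G)" "\<sigma> permutes carrier G"
  shows "mset_finprod G (image_mset (\<lambda>x. x \<otimes> inv (\<sigma> x)) (mset_set (carrier G))) = \<one>"
proof -
  have in_carrier: "\<sigma> x \<in> carrier G" if "x \<in> carrier G" for x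
    using that assms permutes_in_image by metis
  have "finprod G (\<lambda>x. x) (carrier G) = finprod G (\<lambda>x. (x \<otimes> inv (\<sigma> x)) \<otimes> \<sigma> x) (carrier G)"
    by (rule finprod_cong') (auto simp: in_carrier m_assoc)
  also have "\<dots> = finprod G (\<lambda>x. x \<otimes> inv (\<sigma> x)) (carrier G) \<otimes> finprod G \<sigma> (carrier G)"
    by (rule finprod_multf) (auto simp: in_carrier)
  also have "finprod G \<sigma> (carrier G) = finprod G (\<lambda>x. x) (\<sigma> ` carrier G)"
    using assms permutes_inj_on[OF assms(2)] by (subst finprod_reindex) (auto simp: in_carrier)
  also have "\<sigma> ` carrier G = carrier G" using assms(2) by (rule permutes_image)
  finally have "finprod G (\<lambda>x. x \<otimes> inv (\<sigma> x)) (carrier G) = \<one>"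
    using l_cancel_one'[of "finprod G (\<lambda>x. x) (carrier G)" "finprod G (\<lambda>x. x \<otimes> inv (\<sigma> x)) (carrier G)"]
    by (simp add: in_carrier Pi_def)
  thus ?thesis using assms(1) by (subst mset_finprod_image_mset_set) (auto simp: in_carrier)
qed

definition is_difference_mset :: "'a multiset \<Rightarrow> bool"
  where "is_difference_mset M \<longleftrightarrow>
    (\<exists>\<sigma>. \<sigma> permutes carrier G \<and> M = image_mset (\<lambda>x. x \<otimes> inv (\<sigma> x)) (mset_set (carrier G)))"

text \<open>
  Let \<open>a = u - \<sigma> u\<close>, \<open>b = v - \<sigma> v\<close> and \<open>s = u + v - c\<close>. With \<open>\<tau> x = s - \<sigma> x\<close> the difference \<open>x - \<sigma> x\<close>
  becomes \<open>x + \<tau> x - s\<close>, a symmetric label of the edge \<open>{x, \<tau> x}\<close>. The choice of \<open>s\<close> gives the edge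
  \<open>{u, v}\<close> the label \<open>c\<close>, so a 2-opt move at \<open>u\<close> and \<open>v\<close> replaces \<open>a\<close> by \<open>c\<close>; the label
  of the other new edge must be \<open>d\<close> because the sum of the two labels does not change.
\<close>
lemma difference_mset_exchange:
  assumes fin: "finite (carrier G)" and M: "is_difference_mset (M + {#a, b#})"
    and c: "c \<in> carrier G" and d: "d \<in> carrier G" and eq: "a \<otimes> b = c \<otimes> d"
  shows "is_difference_mset (M + {#c, d#})"
proof -
  obtain \<sigma> where sig: "\<sigma> permutes carrier G"
    and Ms: "M + {#a, b#} = image_mset (\<lambda>x. x \<otimes> inv (\<sigma> x)) (mset_set (carrier G))"
    using M by (auto simp: is_difference_mset_def)
  have sc [simp]: "\<sigma> x \<in> carrier G" if "x \<in> carrier G" for x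
    using that sig permutes_in_image by metis
  have "a \<in># image_mset (\<lambda>x. x \<otimes> inv (\<sigma> x)) (mset_set (carrier G))"
    unfolding Ms[symmetric] by simp
  then obtain u where u: "u \<in> carrier G" "a = u \<otimes> inv (\<sigma> u)"
    using fin by auto
  have "add_mset a (M + {#b#}) =
      add_mset a (image_mset (\<lambda>x. x \<otimes> inv (\<sigma> x)) (mset_set (carrier G - {u})))"
    using Ms mset_set.remove[OF fin u(1)] u(2) by simp
  hence M1: "M + {#b#} = image_mset (\<lambda>x. x \<otimes> inv (\<sigma> x)) (mset_set (carrier G - {u}))"
    by simp
  hence "b \<in># image_mset (\<lambda>x. x \<otimes> inv (\<sigma> x)) (mset_set (carrier G - {u}))"
    unfolding M1[symmetric] by simp
  then obtain v where v: "v \<in> carrier G" "v \<noteq> u" "b = v \<otimes> inv (\<sigma> v)"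
    using fin by auto
  define s where "s = u \<otimes> v \<otimes> inv c"
  have s [simp]: "s \<in> carrier G" using u v c by (simp add: s_def)
  define \<tau> where "\<tau> = (\<lambda>x. if x \<in> carrier G then s \<otimes> inv (\<sigma> x) else x)"
  have "inj_on \<tau> (carrier G)"
  proof (rule inj_onI)
    fix x y assume xy: "x \<in> carrier G" "y \<in> carrier G" "\<tau> x = \<tau> y"
    hence "inv (\<sigma> x) = inv (\<sigma> y)" by (simp add: \<tau>_def)
    hence "\<sigma> x = \<sigma> y" using xy by (metis inv_inv sc)
    thus "x = y" using permutes_inj[OF sig] by (simp add: inj_eq)
  qed
  moreover have "\<tau> ` carrier G \<subseteq> carrier G" by (auto simp: \<tau>_def)
  ultimately have "bij_betw \<tau> (carrier G) (carrier G)"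
    using fin by (simp add: bij_betw_def endo_inj_surj)
  hence tau: "\<tau> permutes carrier G" by (rule bij_imp_permutes) (simp add: \<tau>_def)
  \<comment> \<open>the cut-off makes the labelling symmetric for arguments outside the carrier too\<close>
  define h where "h = (\<lambda>x y. if x \<in> carrier G \<and> y \<in> carrier G then x \<otimes> y \<otimes> inv s else \<one>)"
  have sym: "h x y = h y x" for x y by (auto simp: h_def m_comm)
  obtain \<tau>' where tau': "\<tau>' permutes carrier G"
    and E: "image_mset (\<lambda>x. h x (\<tau>' x)) (mset_set (carrier G)) + {#h u (\<tau> u), h v (\<tau> v)#}
     = image_mset (\<lambda>x. h x (\<tau> x)) (mset_set (carrier G)) + {#h u v, h (\<tau> u) (\<tau> v)#}"
    using two_opt[OF fin tau u(1) v(1) v(2)[symmetric], of h] sym by metis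
  have t'c [simp]: "\<tau>' x \<in> carrier G" if "x \<in> carrier G" for x
    using that tau' permutes_in_image by metis
  have cancel: "x \<otimes> (s \<otimes> y) \<otimes> inv s = x \<otimes> y" if "x \<in> carrier G" "y \<in> carrier G" for x y
  proof -
    have "x \<otimes> (s \<otimes> y) \<otimes> inv s = (x \<otimes> y) \<otimes> s \<otimes> inv s"
      using that by (simp add: m_ac)
    also have "\<dots> = (x \<otimes> y) \<otimes> (s \<otimes> inv s)"
      using that by (intro m_assoc) auto
    finally show ?thesis using that by simp
  qed
  have h_tau: "h x (\<tau> x) = x \<otimes> inv (\<sigma> x)" if "x \<in> carrier G" for x
    using that by (simp add: h_def \<tau>_def cancel)
  have huv: "h u v = c"
  proof -
    have "x \<otimes> (c \<otimes> inv x) = c" if "x \<in> carrier G" for x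
      using that c by (simp add: m_lcomm)
    thus ?thesis using u v c by (simp add: h_def s_def inv_mult_group m_ac)
  qed
  have "c \<otimes> h (\<tau> u) (\<tau> v) = h u v \<otimes> h (\<tau> u) (\<tau> v)" by (simp add: huv)
  also have "\<dots> = h u (\<tau> u) \<otimes> h v (\<tau> v)"
    using u v by (simp add: h_def \<tau>_def m_ac)
  also have "\<dots> = c \<otimes> d" using u v h_tau eq by simp
  finally have hd: "h (\<tau> u) (\<tau> v) = d"
    using c d u v by (simp add: h_def \<tau>_def)
  define \<sigma>' where "\<sigma>' = (\<lambda>x. if x \<in> carrier G then s \<otimes> inv (\<tau>' x) else x)"
  have "inj_on \<sigma>' (carrier G)"
  proof (rule inj_onI)
    fix x y assume xy: "x \<in> carrier G" "y \<in> carrier G" "\<sigma>' x = \<sigma>' y"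
    hence "inv (\<tau>' x) = inv (\<tau>' y)" by (simp add: \<sigma>'_def)
    hence "\<tau>' x = \<tau>' y" using xy by (metis inv_inv t'c)
    thus "x = y" using permutes_inj[OF tau'] by (simp add: inj_eq)
  qed
  moreover have "\<sigma>' ` carrier G \<subseteq> carrier G" by (auto simp: \<sigma>'_def)
  ultimately have "bij_betw \<sigma>' (carrier G) (carrier G)"
    using fin by (simp add: bij_betw_def endo_inj_surj)
  hence sig': "\<sigma>' permutes carrier G" by (rule bij_imp_permutes) (simp add: \<sigma>'_def)
  have h_tau': "h x (\<tau>' x) = x \<otimes> inv (\<sigma>' x)" if "x \<in> carrier G" for x
    using that by (simp add: h_def \<sigma>'_def inv_mult_group m_ac)
  have "image_mset (\<lambda>x. x \<otimes> inv (\<sigma>' x)) (mset_set (carrier G)) + {#a, b#}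
      = image_mset (\<lambda>x. h x (\<tau>' x)) (mset_set (carrier G)) + {#h u (\<tau> u), h v (\<tau> v)#}"
    using fin u v h_tau h_tau' by (auto intro!: image_mset_cong)
  also have "\<dots> = image_mset (\<lambda>x. x \<otimes> inv (\<sigma> x)) (mset_set (carrier G)) + {#c, d#}"
    unfolding E huv hd using fin h_tau by (auto intro!: image_mset_cong)
  also have "\<dots> = (M + {#c, d#}) + {#a, b#}"
    unfolding Ms[symmetric] by (simp add: ac_simps)
  finally have "M + {#c, d#} = image_mset (\<lambda>x. x \<otimes> inv (\<sigma>' x)) (mset_set (carrier G))"
    by simp
  with sig' show ?thesis by (auto simp: is_difference_mset_def)
qed

text \<open>
  The identity permutation yields the multiset of neutral elements. Any other multiset with product
  \<open>\<one>\<close> has two elements \<open>c\<close>, \<open>d\<close> different from \<open>\<one>\<close>, since a single one would be the product.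
  It arises by an exchange from the multiset with \<open>\<one>\<close> and \<open>c \<otimes> d\<close> in their place, which has
  fewer such elements.
\<close>
theorem hall_difference_mset:
  assumes fin: "finite (carrier G)" and "set_mset M \<subseteq> carrier G" "size M = Coset.order G"
    and "mset_finprod G M = \<one>"
  shows "is_difference_mset M"
  using assms(2-)
proof (induction "size (filter_mset (\<lambda>x. x \<noteq> \<one>) M)" arbitrary: M rule: less_induct)
  case less
  show ?case
  proof (cases "\<exists>c \<in># M. c \<noteq> \<one>")
    case False
    hence "set_mset M \<subseteq> {\<one>}" by auto
    hence "M = replicate_mset (Coset.order G) \<one>"
      using less.prems(2) set_mset_subset_singletonD by metis
    moreover have "image_mset (\<lambda>x. x \<otimes> inv (id x)) (mset_set (carrier G)) = image_mset (\<lambda>_. \<one>) (mset_set (carrier G))"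
      by (rule image_mset_cong) (use fin in auto)
    ultimately show ?thesis
      unfolding is_difference_mset_def using permutes_id
      by (intro exI[of _ id]) (auto simp: image_mset_const_eq Coset.order_def)
  next
    case True
    then obtain c N where N: "M = add_mset c N" and c: "c \<noteq> \<one>" "c \<in> carrier G"
      using less.prems(1) by (metis insert_DiffM subsetD)
    have Nc: "set_mset N \<subseteq> carrier G" using less.prems(1) N by simp
    have prod: "c \<otimes> mset_finprod G N = \<one>"
      using less.prems(3) N c fin by (simp add: mset_finprod_add_mset)
    have triv: "mset_finprod G K = \<one>" if "\<forall>x\<in>#K. x = \<one>" for K
      unfolding mset_finprod_def
    proof (rule finprod_one_eqI)
      fix g assume "g \<in> carrier G"
      show "g [^] count K g = \<one>"
      proof (cases "g \<in># K")
        case True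
        with that have "g = \<one>" by blast
        thus ?thesis by simp
      next
        case False
        thus ?thesis by (simp add: not_in_iff)
      qed
    qed
    obtain d where d: "d \<in># N" "d \<noteq> \<one>"
    proof (rule ccontr)
      assume "\<not> thesis"
      hence "mset_finprod G N = \<one>" using that by (intro triv) blast
      thus False using prod c by simp
    qed
    then obtain K where K: "N = add_mset d K" by (metis insert_DiffM)
    have dc: "d \<in> carrier G" using d Nc by auto
    let ?L = "add_mset \<one> (add_mset (c \<otimes> d) K)"
    have "is_difference_mset ?L"
    proof (rule less.hyps)
      show "size {#x \<in># ?L. x \<noteq> \<one>#} < size {#x \<in># M. x \<noteq> \<one>#}"
        using c d by (simp add: N K)
      show "set_mset ?L \<subseteq> carrier G" using Nc K c dc by auto
      show "size ?L = Coset.order G" using less.prems(2) N K by simp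
      have "mset_finprod G M = mset_finprod G ?L"
        using c dc fin by (simp add: N K mset_finprod_add_mset m_assoc)
      thus "mset_finprod G ?L = \<one>" using less.prems(3) by simp
    qed
    hence "is_difference_mset (K + {#\<one>, c \<otimes> d#})" by simp
    hence "is_difference_mset (K + {#c, d#})"
      by (rule difference_mset_exchange[OF fin]) (use c dc in auto)
    thus ?thesis by (simp add: N K add_mset_commute)
  qed
qed

end


section \<open>Monomials of the group permanent\<close>

definition monom_of_mset :: "'a multiset \<Rightarrow> ('a \<Rightarrow>\<^sub>0 nat)"
  where "monom_of_mset M = (\<Sum>x\<in>#M. Poly_Mapping.single x 1)"

lemma lookup_monom_of_mset: "Poly_Mapping.lookup (monom_of_mset M) x = count M x"
  by (induction M) (auto simp: monom_of_mset_def lookup_add lookup_single when_def)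

lemma inj_monom_of_mset: "inj monom_of_mset"
  by (rule injI) (metis lookup_monom_of_mset multiset_eqI)

lemma prod_indet:
  assumes "finite A"
  shows "(\<Prod>i\<in>A. indet (f i)) = Poly_Mapping.single (monom_of_mset (image_mset f (mset_set A))) 1"
  using assms
  by (induction A rule: finite_induct)
     (simp_all add: indet_def monom_of_mset_def mult_single flip: single_one)

lemma keys_sum_single_one:
  assumes "finite S"
  shows "Poly_Mapping.keys (\<Sum>s\<in>S. Poly_Mapping.single (e s) (1 :: int)) = e ` S"
proof -
  have "Poly_Mapping.lookup (\<Sum>s\<in>S. Poly_Mapping.single (e s) (1 :: int)) x
      = int (card {s \<in> S. x = e s})" for x
    using assms by (simp add: lookup_sum lookup_single when_def sum.If_cases Int_def)
  thus ?thesis using assms by (auto simp: in_keys_iff)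
qed

text \<open>
  Each permutation contributes one monomial with coefficient 1, so nothing cancels and the monomials are
  exactly the difference multisets, which Hall's theorem describes.
\<close>
lemma (in comm_group) num_monomials_group_permanent:
  assumes fin: "finite (carrier G)"
  shows "num_monomials (group_permanent G)
    = card {M \<in> multisets_of_size (carrier G) (Coset.order G). mset_finprod G M = \<one>}"
proof -
  have finS: "finite {\<sigma>. \<sigma> permutes carrier G}" using fin by (rule finite_permutations)
  define D where "D = (\<lambda>\<sigma>. image_mset (\<lambda>x. x \<otimes> inv (\<sigma> x)) (mset_set (carrier G)))"
  have "group_permanent G
      = (\<Sum>\<sigma> | \<sigma> permutes carrier G. Poly_Mapping.single (monom_of_mset (D \<sigma>)) 1)"
    unfolding group_permanent_def permanent_def group_matrix_def D_def prod_indet[OF fin] ..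
  hence "Poly_Mapping.keys (group_permanent G)
      = (\<lambda>\<sigma>. monom_of_mset (D \<sigma>)) ` {\<sigma>. \<sigma> permutes carrier G}"
    using keys_sum_single_one[OF finS] by simp
  also have "\<dots> = monom_of_mset ` D ` {\<sigma>. \<sigma> permutes carrier G}"
    by (simp add: image_image)
  also have "D ` {\<sigma>. \<sigma> permutes carrier G}
      = {M \<in> multisets_of_size (carrier G) (Coset.order G). mset_finprod G M = \<one>}"
  proof (intro equalityI subsetI)
    fix M assume "M \<in> D ` {\<sigma>. \<sigma> permutes carrier G}"
    then obtain \<sigma> where s: "\<sigma> permutes carrier G" "M = D \<sigma>" by auto
    have "x \<otimes> inv (\<sigma> x) \<in> carrier G" if "x \<in> carrier G" for x
      using that permutes_in_image[OF s(1), of x] by simp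
    hence "set_mset M \<subseteq> carrier G" "size M = Coset.order G"
      using fin s(2) by (auto simp: D_def Coset.order_def)
    thus "M \<in> {M \<in> multisets_of_size (carrier G) (Coset.order G). mset_finprod G M = \<one>}"
      using mset_finprod_differences[OF fin s(1)] s(2) by (auto simp: multisets_of_size_def D_def)
  next
    fix M assume "M \<in> {M \<in> multisets_of_size (carrier G) (Coset.order G). mset_finprod G M = \<one>}"
    hence "is_difference_mset M"
      by (intro hall_difference_mset[OF fin]) (auto simp: multisets_of_size_def)
    thus "M \<in> D ` {\<sigma>. \<sigma> permutes carrier G}"
      unfolding is_difference_mset_def D_def by blast
  qed
  finally have "Poly_Mapping.keys (group_permanent G)
      = monom_of_mset ` {M \<in> multisets_of_size (carrier G) (Coset.order G). mset_finprod G M = \<one>}" .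
  thus ?thesis unfolding num_monomials_def
    by (simp add: card_image[OF inj_on_subset[OF inj_monom_of_mset subset_UNIV]])
qed

section \<open>Generating functions of multisets\<close>

lemma fps_geometric: "inverse (1 - fps_const c * fps_X) = Abs_fps (\<lambda>k. (c :: 'a :: field_char_0) ^ k)"
  using one_minus_const_fps_X_neg_power'[of 1 c] by simp

lemma sum_multisets_of_size_prod:
  fixes c :: "'a \<Rightarrow> 'b :: field_char_0"
  assumes "finite A"
  shows "(\<Sum>M\<in>multisets_of_size A n. \<Prod>g\<in>A. c g ^ count M g)
       = fps_nth (inverse (\<Prod>g\<in>A. 1 - fps_const (c g) * fps_X)) n"
  using fps_prod_nth'[OF assms, of "\<lambda>g. inverse (1 - fps_const (c g) * fps_X)" n]
  by (simp add: inverse_prod_fps fps_geometric)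

definition half_central_binomial :: "nat \<Rightarrow> nat"
  where "half_central_binomial N = (2 * N - 1) choose (N - 1)"

lemma fps_nth_compose_X_power:
  fixes f :: "'a :: comm_ring_1 fps"
  assumes "d > 0"
  shows "fps_nth (f oo fps_X ^ d) (d * k) = fps_nth f k"
proof -
  have "fps_nth (f oo fps_X ^ d) (d * k) = (\<Sum>i=0..d*k. if i = k then fps_nth f i else 0)"
    unfolding fps_compose_nth using assms by (intro sum.cong) (auto simp flip: power_mult)
  also have "\<dots> = fps_nth f k" using assms by simp
  finally show ?thesis .
qed

text \<open>
  Substituting \<open>X\<close> for \<open>X ^ d\<close> reduces to the coefficient of \<open>X ^ k\<close> in \<open>(1 - X) ^ (-k)\<close>.
\<close>
lemma half_central_coefficient:
  assumes "d > 0" "k > 0"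
  shows "fps_nth (inverse ((1 - fps_X ^ d) ^ k)) (d * k) = (of_nat (half_central_binomial k) :: 'a :: field_char_0)"
proof -
  have "inverse ((1 - fps_X ^ d) ^ k) = inverse ((1 - fps_X) ^ k) oo (fps_X ^ d :: 'a fps)"
    using assms
    by (subst fps_inverse_compose)
       (simp_all add: fps_compose_sub_distrib flip: fps_compose_power)
  hence "fps_nth (inverse ((1 - fps_X ^ d) ^ k)) (d * k) = fps_nth (inverse ((1 - fps_X :: 'a fps) ^ k)) k"
    using assms by (simp add: fps_nth_compose_X_power)
  also have "inverse ((1 - fps_X :: 'a fps) ^ k) = Abs_fps (\<lambda>i. of_nat ((k + i - 1) choose i))"
    using one_minus_const_fps_X_neg_power'[of k "1 :: 'a"] assms by simp
  also have "fps_nth \<dots> k = of_nat ((2 * k - 1) choose k)" by (simp add: mult_2)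
  also have "(2 * k - 1) choose k = half_central_binomial k"
    using binomial_symmetric[of k "2 * k - 1"] assms by (simp add: half_central_binomial_def mult_2)
  finally show ?thesis .
qed

text \<open>
  Both sides are polynomials of degree at most \<open>d\<close> which agree at \<open>d + 1\<close> points: at the roots of unity
  and at 0.
\<close>
lemma prod_roots_of_unity:
  assumes "d > 0"
  shows "(\<Prod>z | z ^ d = 1. 1 - fps_const z * fps_X) = 1 - (fps_X ^ d :: complex fps)"
proof -
  let ?R = "{z :: complex. z ^ d = 1}"
  have fin: "finite ?R" and card: "card ?R = d"
    using assms by (auto simp: card_roots_unity_eq intro: finite_roots_unity)
  define P where "P = (\<Prod>z\<in>?R. [:1, - z:])"
  define Q where "Q = (1 - Polynomial.monom 1 d :: complex poly)"
  have "P = Q"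
  proof (rule poly_eqI_degree)
    fix w assume "w \<in> insert 0 ?R"
    thus "poly P w = poly Q w"
    proof
      assume "w = 0"
      thus ?thesis using assms by (simp add: P_def Q_def poly_prod poly_monom power_0_left)
    next
      assume w: "w \<in> ?R"
      hence "w \<noteq> 0" using assms by (auto simp: power_0_left)
      hence "inverse w \<in> ?R" "poly [:1, - inverse w:] w = 0" using w by (auto simp: power_inverse)
      hence "poly P w = 0" unfolding P_def poly_prod using fin by (metis (no_types, lifting) prod_zero)
      moreover have "poly Q w = 0" using w by (simp add: Q_def poly_monom)
      ultimately show ?thesis by simp
    qed
  next
    have card': "card (insert 0 ?R) = Suc d"
      using fin card assms by (subst card_insert_disjoint) (auto simp: power_0_left)
    have "degree P \<le> (\<Sum>z\<in>?R. 1)"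
      unfolding P_def
      by (rule order.trans[OF degree_prod_sum_le[OF fin]]) (intro sum_mono, simp)
    thus "degree P < card (insert 0 ?R)" using card card' by simp
    have "degree Q \<le> d" unfolding Q_def by (rule degree_diff_le) (auto simp: degree_monom_le)
    thus "degree Q < card (insert 0 ?R)" using card' by simp
  qed
  hence "fps_of_poly P = fps_of_poly Q" by simp
  thus ?thesis
    by (simp add: P_def Q_def fps_of_poly_prod fps_of_poly_diff fps_of_poly_monom fps_of_poly_linear'
        flip: fps_const_neg)
qed

section \<open>Counting zero-sum multisets with characters\<close>

text \<open>
  For a prime power order, being a primitive root only needs to be tested at the exponent
  \<open>p ^ (e - 1)\<close>, because this is a multiple of every proper divisor of \<open>p ^ e\<close>.
\<close>
lemma root_of_unity_powers:
  fixes \<omega> :: complex and p :: nat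
  assumes p: "prime p" and w: "\<omega> ^ (p ^ e) = 1" and prim: "e > 0 \<Longrightarrow> \<omega> ^ (p ^ (e - 1)) \<noteq> 1"
  shows "(\<lambda>j. \<omega> ^ j) ` {..<p ^ e} = {z. z ^ (p ^ e) = 1}"
proof -
  have pe: "p ^ e > 0" using p by (simp add: prime_gt_0_nat)
  have w0: "\<omega> \<noteq> 0" using w pe by (auto simp: power_0_left)
  have no: "\<omega> ^ k \<noteq> 1" if k: "0 < k" "k < p ^ e" for k
  proof
    assume 1: "\<omega> ^ k = 1"
    obtain x y where xy: "k * x = p ^ e * y + gcd k (p ^ e)" using bezout_nat[of k "p ^ e"] k by auto
    have "\<omega> ^ (k * x) = 1" "\<omega> ^ (p ^ e * y) = 1" using 1 w by (simp_all add: power_mult)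
    hence g1: "\<omega> ^ gcd k (p ^ e) = 1" using xy by (simp add: power_add)
    obtain f where f: "f \<le> e" "gcd k (p ^ e) = p ^ f"
      using divides_primepow_nat[OF p, of "gcd k (p ^ e)" e] by auto
    have "gcd k (p ^ e) \<le> k" using k by (intro dvd_imp_le) auto
    hence "f \<noteq> e" using f k by auto
    hence fe: "f \<le> e - 1" "e > 0" using f by auto
    have "p ^ (e - 1) = p ^ f * p ^ (e - 1 - f)" using fe by (simp flip: power_add)
    hence "\<omega> ^ (p ^ (e - 1)) = 1" using g1 f by (simp add: power_mult)
    thus False using prim fe by simp
  qed
  have aux: "\<omega> ^ i \<noteq> \<omega> ^ j" if "i < j" "j < p ^ e" for i j
  proof
    assume "\<omega> ^ i = \<omega> ^ j"
    also have "\<omega> ^ j = \<omega> ^ i * \<omega> ^ (j - i)" using that by (simp flip: power_add)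
    finally have "\<omega> ^ (j - i) = 1" using w0 by simp
    thus False using no[of "j - i"] that by simp
  qed
  have inj: "inj_on (\<lambda>j. \<omega> ^ j) {..<p ^ e}"
    by (rule inj_onI) (metis aux lessThan_iff linorder_neqE_nat)
  have sub: "(\<lambda>j. \<omega> ^ j) ` {..<p ^ e} \<subseteq> {z. z ^ (p ^ e) = 1}"
    using w by (auto simp flip: power_mult) (metis mult.commute power_mult power_one)
  show ?thesis
    using sub pe inj
    by (intro card_subset_eq) (auto simp: card_image card_roots_unity_eq intro: finite_roots_unity)
qed

context comm_group
begin

lemma character_one:
  fixes \<chi> :: "'a \<Rightarrow> complex"
  assumes "\<And>x y. x \<in> carrier G \<Longrightarrow> y \<in> carrier G \<Longrightarrow> \<chi> (x \<otimes> y) = \<chi> x * \<chi> y" "\<chi> \<one> \<noteq> 0"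
  shows "\<chi> \<one> = 1"
  using assms(1)[of \<one> \<one>] assms(2) by simp

lemma character_pow:
  fixes \<chi> :: "'a \<Rightarrow> complex"
  assumes "\<And>x y. x \<in> carrier G \<Longrightarrow> y \<in> carrier G \<Longrightarrow> \<chi> (x \<otimes> y) = \<chi> x * \<chi> y" "\<chi> \<one> \<noteq> 0"
    and "x \<in> carrier G"
  shows "\<chi> (x [^] (n :: nat)) = \<chi> x ^ n"
  by (induction n) (use assms character_one[of \<chi>] in auto)

lemma character_mset_finprod:
  fixes \<chi> :: "'a \<Rightarrow> complex"
  assumes "\<And>x y. x \<in> carrier G \<Longrightarrow> y \<in> carrier G \<Longrightarrow> \<chi> (x \<otimes> y) = \<chi> x * \<chi> y" "\<chi> \<one> \<noteq> 0"
  assumes fin: "finite (carrier G)"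
  shows "\<chi> (mset_finprod G M) = (\<Prod>g\<in>carrier G. \<chi> g ^ count M g)"
proof -
  have "\<chi> (finprod G (\<lambda>g. g [^] count M g) A) = (\<Prod>g\<in>A. \<chi> g ^ count M g)"
    if "finite A" "A \<subseteq> carrier G" for A
    using that
  proof (induction A rule: finite_induct)
    case (insert a A)
    thus ?case using assms character_pow[of \<chi>, OF assms(1,2)]
      by (subst finprod_insert) (auto simp: Pi_def subset_iff intro!: finprod_closed)
  qed (use character_one[of \<chi>] assms in simp)
  thus ?thesis unfolding mset_finprod_def using fin by blast
qed

lemma sum_nontrivial_character:
  fixes \<chi> :: "'a \<Rightarrow> complex"
  assumes hom: "\<And>x y. x \<in> carrier G \<Longrightarrow> y \<in> carrier G \<Longrightarrow> \<chi> (x \<otimes> y) = \<chi> x * \<chi> y"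
    and a: "a \<in> carrier G" "\<chi> a \<noteq> 1"
  shows "(\<Sum>x\<in>carrier G. \<chi> x) = 0"
proof -
  have "(\<Sum>x\<in>carrier G. \<chi> x) = (\<Sum>x\<in>carrier G. \<chi> (a \<otimes> x))"
    by (rule sum.reindex_bij_witness[where j = "\<lambda>x. inv a \<otimes> x" and i = "\<lambda>x. a \<otimes> x"])
       (use a in \<open>auto simp flip: m_assoc\<close>)
  also have "\<dots> = \<chi> a * (\<Sum>x\<in>carrier G. \<chi> x)" using a by (simp add: hom sum_distrib_left)
  finally show ?thesis using a(2) by (metis mult_cancel_right1)
qed

text \<open>
  The values of a character of order \<open>p ^ e\<close> are all the \<open>p ^ e\<close>-th roots of unity, and its fibres are
  translates of each other, so each value is taken \<open>p ^ (m - e)\<close> times.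
\<close>
lemma prod_one_minus_character:
  fixes \<chi> :: "'a \<Rightarrow> complex" and p :: nat
  assumes hom: "\<And>x y. x \<in> carrier G \<Longrightarrow> y \<in> carrier G \<Longrightarrow> \<chi> (x \<otimes> y) = \<chi> x * \<chi> y" "\<chi> \<one> \<noteq> 0"
    and fin: "finite (carrier G)" and p: "prime p" and order: "Coset.order G = p ^ m" and e: "e \<le> m"
    and pe: "\<And>x. x \<in> carrier G \<Longrightarrow> \<chi> x ^ (p ^ e) = 1"
    and prim: "e > 0 \<Longrightarrow> \<exists>y\<in>carrier G. \<chi> y ^ (p ^ (e - 1)) \<noteq> 1"
  shows "(\<Prod>g\<in>carrier G. 1 - fps_const (\<chi> g) * fps_X) = (1 - fps_X ^ (p ^ e)) ^ (p ^ (m - e))"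
proof -
  define R where "R = {z :: complex. z ^ (p ^ e) = 1}"
  define F where "F = (\<lambda>z. {g \<in> carrier G. \<chi> g = z})"
  have d0: "p ^ e > 0" using p by (simp add: prime_gt_0_nat)
  have finR: "finite R" using d0 by (auto simp: R_def intro: finite_roots_unity)
  have cardR: "card R = p ^ e" using d0 by (simp add: R_def card_roots_unity_eq)
  have chiR: "\<chi> ` carrier G \<subseteq> R" using pe by (auto simp: R_def)
  obtain y where y: "y \<in> carrier G" "e > 0 \<Longrightarrow> \<chi> y ^ (p ^ (e - 1)) \<noteq> 1"
    using prim one_closed by (metis gr0I)
  have fibre: "card (F z) = card (F 1)" if zR: "z \<in> R" for z
  proof -
    obtain j where j: "z = \<chi> y ^ j"
      using root_of_unity_powers[OF p pe[OF y(1)] y(2)] zR unfolding R_def by blast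
    define h where "h = y [^] j"
    have h: "h \<in> carrier G" "\<chi> h = z"
      using y j character_pow[of \<chi>, OF hom] by (auto simp: h_def)
    have z0: "z \<noteq> 0" using zR d0 by (auto simp: R_def power_0_left)
    have ih: "\<chi> (inv h) * z = 1" using hom(1)[of "inv h" h] h character_one[of \<chi>, OF hom] by simp
    have "bij_betw (\<lambda>x. h \<otimes> x) (F 1) (F z)"
    proof (rule bij_betw_byWitness[where f' = "\<lambda>x. inv h \<otimes> x"])
      show "\<forall>x\<in>F 1. inv h \<otimes> (h \<otimes> x) = x" "\<forall>x\<in>F z. h \<otimes> (inv h \<otimes> x) = x"
        using h by (auto simp: F_def simp flip: m_assoc)
      show "(\<otimes>) h ` F 1 \<subseteq> F z" using h by (auto simp: F_def hom)
      show "(\<otimes>) (inv h) ` F z \<subseteq> F 1" using h ih by (auto simp: F_def hom)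
    qed
    thus ?thesis by (simp add: bij_betw_same_card)
  qed
  have "p ^ m = (\<Sum>g\<in>carrier G. 1)" using order by (simp add: Coset.order_def)
  also have "\<dots> = (\<Sum>z\<in>R. \<Sum>g\<in>F z. 1)"
    unfolding F_def by (rule sum.group[OF fin finR chiR, symmetric])
  also have "\<dots> = p ^ e * card (F 1)" using fibre cardR by simp
  finally have "p ^ e * p ^ (m - e) = p ^ e * card (F 1)" using e by (simp flip: power_add)
  hence F1: "card (F 1) = p ^ (m - e)" unfolding nat_mult_eq_cancel1[OF d0] ..
  have "(\<Prod>g\<in>carrier G. 1 - fps_const (\<chi> g) * fps_X)
      = (\<Prod>z\<in>R. \<Prod>g\<in>F z. 1 - fps_const (\<chi> g) * fps_X)"
    unfolding F_def by (rule prod.group[OF fin finR chiR, symmetric])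
  also have "\<dots> = (\<Prod>z\<in>R. (1 - fps_const z * fps_X) ^ (p ^ (m - e)))"
  proof (rule prod.cong)
    fix z assume "z \<in> R"
    have "(\<Prod>g\<in>F z. 1 - fps_const (\<chi> g) * fps_X) = (\<Prod>g\<in>F z. 1 - fps_const z * fps_X)"
      by (rule prod.cong) (auto simp: F_def)
    thus "(\<Prod>g\<in>F z. 1 - fps_const (\<chi> g) * fps_X) = (1 - fps_const z * fps_X) ^ (p ^ (m - e))"
      using fibre[OF \<open>z \<in> R\<close>] F1 by simp
  qed simp
  also have "\<dots> = (1 - fps_X ^ (p ^ e)) ^ (p ^ (m - e))"
    unfolding prod_power_distrib[symmetric] R_def using prod_roots_of_unity[OF d0] by simp
  finally show ?thesis .
qed

text \<open>
  A symmetric nondegenerate pairing of the group with itself supplies enough characters, indexed by the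
  group elements: nondegeneracy gives orthogonality, and together with symmetry it makes the order of
  the character \<open>\<chi> a\<close> equal to the order \<open>p ^ e a\<close> of \<open>a\<close>.
\<close>
lemma count_one_product_multisets:
  fixes \<chi> :: "'a \<Rightarrow> 'a \<Rightarrow> complex" and p :: nat and e :: "'a \<Rightarrow> nat"
  assumes fin: "finite (carrier G)" and p: "prime p" and order: "Coset.order G = p ^ m"
    and hom: "\<And>a x y. a \<in> carrier G \<Longrightarrow> x \<in> carrier G \<Longrightarrow> y \<in> carrier G \<Longrightarrow>
        \<chi> a (x \<otimes> y) = \<chi> a x * \<chi> a y"
    and sym: "\<And>a x. \<chi> a x = \<chi> x a"
    and nz: "\<And>a x. \<chi> a x \<noteq> 0"
    and nondeg: "\<And>x. x \<in> carrier G \<Longrightarrow> x \<noteq> \<one> \<Longrightarrow> \<exists>a\<in>carrier G. \<chi> a x \<noteq> 1"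
  defines "e \<equiv> \<lambda>a. LEAST i. a [^] (p ^ i) = \<one>"
  shows "p ^ m * card {M \<in> multisets_of_size (carrier G) (Coset.order G). mset_finprod G M = \<one>}
       = (\<Sum>a\<in>carrier G. half_central_binomial (p ^ (m - e a)))"
proof -
  define Z where "Z = {M \<in> multisets_of_size (carrier G) (Coset.order G). mset_finprod G M = \<one>}"
  have finM: "finite (multisets_of_size (carrier G) (Coset.order G))"
    using fin by (rule finite_multisets_of_size)
  have ann: "a [^] (p ^ m) = \<one>" if "a \<in> carrier G" for a
    using pow_order_eq_1[OF that] order by simp
  have e: "a [^] (p ^ e a) = \<one>" "e a \<le> m" "i < e a \<Longrightarrow> a [^] (p ^ i) \<noteq> \<one>" if "a \<in> carrier G" for a i
    unfolding e_def using ann[OF that] by (auto intro: LeastI Least_le dest: not_less_Least)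
  have orth: "(\<Sum>a\<in>carrier G. \<chi> a x) = (if x = \<one> then of_nat (p ^ m) else 0)"
    if x: "x \<in> carrier G" for x
  proof (cases "x = \<one>")
    case True
    have "\<chi> a \<one> = 1" if "a \<in> carrier G" for a
      using character_one[of "\<chi> a", OF hom[OF that]] nz by blast
    thus ?thesis using True order by (simp add: Coset.order_def)
  next
    case False
    then obtain a where "a \<in> carrier G" "\<chi> x a \<noteq> 1" using nondeg[OF x] sym by metis
    hence "(\<Sum>a\<in>carrier G. \<chi> x a) = 0"
      by (intro sum_nontrivial_character) (use x hom in auto)
    thus ?thesis using False by (simp add: sym[of x])
  qed
  have coeff: "(\<Sum>M\<in>multisets_of_size (carrier G) (Coset.order G). \<chi> a (mset_finprod G M))
      = of_nat (half_central_binomial (p ^ (m - e a)))" if a: "a \<in> carrier G" for a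
  proof -
    have ord: "Coset.order G = p ^ e a * p ^ (m - e a)"
      using order e(2)[OF a] by (simp flip: power_add)
    have "(\<Sum>M\<in>multisets_of_size (carrier G) (Coset.order G). \<chi> a (mset_finprod G M))
        = fps_nth (inverse (\<Prod>g\<in>carrier G. 1 - fps_const (\<chi> a g) * fps_X)) (Coset.order G)"
      using character_mset_finprod[of "\<chi> a", OF hom[OF a] nz fin]
      by (simp add: sum_multisets_of_size_prod[OF fin])
    also have "(\<Prod>g\<in>carrier G. 1 - fps_const (\<chi> a g) * fps_X)
        = (1 - fps_X ^ (p ^ e a)) ^ (p ^ (m - e a))"
    proof (rule prod_one_minus_character[OF hom[OF a] nz fin p order e(2)[OF a]])
      have pw: "\<chi> a x ^ n = \<chi> x (a [^] n)" if "x \<in> carrier G" for x n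
        using character_pow[of "\<chi> x", OF hom[OF that] nz a, of n] by (simp add: sym[of a])
      show "\<chi> a x ^ (p ^ e a) = 1" if x: "x \<in> carrier G" for x
        using character_one[of "\<chi> x", OF hom[OF x] nz] e(1)[OF a] pw[OF x] by simp
      show "\<exists>y\<in>carrier G. \<chi> a y ^ (p ^ (e a - 1)) \<noteq> 1" if "e a > 0"
        using nondeg[of "a [^] (p ^ (e a - 1))"] e(3)[OF a, of "e a - 1"] a that pw by auto
    qed auto
    also have "fps_nth (inverse ((1 - fps_X ^ (p ^ e a)) ^ (p ^ (m - e a)))) (Coset.order G)
        = (of_nat (half_central_binomial (p ^ (m - e a))) :: complex)"
      unfolding ord by (rule half_central_coefficient) (use p in \<open>auto simp: prime_gt_0_nat\<close>)
    finally show ?thesis .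
  qed
  have "of_nat (p ^ m * card Z)
      = (\<Sum>M\<in>multisets_of_size (carrier G) (Coset.order G). if mset_finprod G M = \<one> then of_nat (p ^ m) else (0 :: complex))"
    using finM by (simp add: Z_def sum.If_cases Int_def)
  also have "\<dots> = (\<Sum>M\<in>multisets_of_size (carrier G) (Coset.order G). \<Sum>a\<in>carrier G. \<chi> a (mset_finprod G M))"
    by (simp add: orth)
  also have "\<dots> = (\<Sum>a\<in>carrier G. \<Sum>M\<in>multisets_of_size (carrier G) (Coset.order G). \<chi> a (mset_finprod G M))"
    by (rule sum.swap)
  also have "\<dots> = of_nat (\<Sum>a\<in>carrier G. half_central_binomial (p ^ (m - e a)))" by (simp add: coeff)
  finally show ?thesis unfolding Z_def of_nat_eq_iff .
qed

end

section \<open>Binomial coefficients modulo powers of a prime\<close>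

lemma fact_add_eq_prod: "fact (N + m) = (fact N :: nat) * (\<Prod>k=1..m. N + k)"
  by (induction m) (simp_all add: algebra_simps)

lemma half_central_mult_prod:
  assumes "N > 0"
  shows "half_central_binomial N * (\<Prod>k=1..N-1. k) = (\<Prod>k=1..N-1. N + k)"
proof -
  have "fact N * (half_central_binomial N * (\<Prod>k=1..N-1. k)) = fact (N - 1) * fact N * half_central_binomial N"
    by (simp add: fact_prod)
  also have "\<dots> = fact (2 * N - 1)"
    using binomial_fact_lemma[of "N - 1" "2 * N - 1"] assms
    by (simp add: half_central_binomial_def Suc_diff_Suc mult_2 numeral_2_eq_2)
  also have "2 * N - 1 = N + (N - 1)" using assms by simp
  also have "fact (N + (N - 1)) = (fact N :: nat) * (\<Prod>k=1..N-1. N + k)"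
    by (rule fact_add_eq_prod)
  finally show ?thesis by simp
qed

definition units_below :: "nat \<Rightarrow> nat \<Rightarrow> nat set"
  where "units_below p N = {k \<in> {1..N-1}. \<not> p dvd k}"

text \<open>
  In \<open>binom(2N - 1, N - 1) = \<Prod>\<^sub>k\<^sub><\<^sub>N (N + k) / k\<close> with \<open>N = p M\<close>, the factors for the multiples \<open>k = p l\<close>
  are \<open>(M + l) / l\<close> and form the same coefficient for \<open>M\<close>.
\<close>
lemma half_central_ratio:
  assumes "p > 0" "M > 0"
  defines "U \<equiv> units_below p (p * M)"
  shows "half_central_binomial M * (\<Prod>k\<in>U. p * M + k) = half_central_binomial (p * M) * (\<Prod>k\<in>U. k)"
proof -
  let ?N = "p * M" and ?V = "(*) p ` {1..M-1}"
  have mult_in: "x \<in> ?V" if dx: "p dvd x" and xr: "x \<in> {1..?N-1}" for x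
  proof -
    obtain l where l: "x = p * l" using dx by blast
    have "p * M > 0" using assms(1,2) by simp
    hence "p * l < p * M" using xr unfolding l by (simp only: atLeastAtMost_iff) linarith
    hence "l < M" by simp
    moreover have "l \<noteq> 0" using xr unfolding l by (intro notI) simp
    ultimately show ?thesis unfolding l by (intro image_eqI[of _ _ l]) auto
  qed
  have in_mult: "p * l \<in> {1..?N-1}" if "l \<in> {1..M-1}" for l
  proof -
    have "l < M" "l > 0" using that assms(2) by auto
    hence "p * l < p * M" "p * l > 0" using assms(1) by simp_all
    thus ?thesis unfolding atLeastAtMost_iff by linarith
  qed
  have un: "{1..?N-1} = ?V \<union> U"
    using mult_in in_mult unfolding U_def units_below_def by blast
  have dj: "?V \<inter> U = {}" by (auto simp: U_def units_below_def)
  have finU: "finite U" by (simp add: U_def units_below_def)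
  have split: "(\<Prod>k=1..?N-1. f k) = (\<Prod>l=1..M-1. f (p * l)) * (\<Prod>k\<in>U. f k)" for f :: "nat \<Rightarrow> nat"
    unfolding un using finU dj assms(1)
    by (subst prod.union_disjoint) (auto simp: prod.reindex inj_on_def)
  have "(\<Prod>l=1..M-1. ?N + p * l) = (\<Prod>l=1..M-1. p * (M + l))"
    by (simp add: algebra_simps)
  also have "\<dots> = p ^ (M - 1) * (\<Prod>l=1..M-1. M + l)"
    by (simp add: prod.distrib)
  finally have "(p ^ (M - 1) * (\<Prod>l=1..M-1. l)) * (half_central_binomial M * (\<Prod>k\<in>U. ?N + k)) = (\<Prod>k=1..?N-1. ?N + k)"
    using half_central_mult_prod[OF assms(2)] unfolding split by (simp add: mult_ac)
  also have "\<dots> = half_central_binomial ?N * (\<Prod>k=1..?N-1. k)"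
    using half_central_mult_prod[of ?N] assms by simp
  also have "\<dots> = (p ^ (M - 1) * (\<Prod>l=1..M-1. l)) * (half_central_binomial ?N * (\<Prod>k\<in>U. k))"
    unfolding split by (simp add: prod.distrib mult_ac)
  finally show ?thesis using assms(1) by simp
qed

lemma prod_add_const_cong:
  fixes u :: "'a \<Rightarrow> int"
  assumes "finite U"
  shows "[(\<Prod>k\<in>U. t + u k) = (\<Prod>k\<in>U. u k) + t * (\<Sum>k\<in>U. \<Prod>l\<in>U-{k}. u l)] (mod t\<^sup>2)"
  using assms
proof (induction U rule: finite_induct)
  case (insert x F)
  have 1: "(\<Sum>k\<in>F. \<Prod>l\<in>insert x F-{k}. u l) = u x * (\<Sum>k\<in>F. \<Prod>l\<in>F-{k}. u l)"
  proof -
    have "(\<Prod>l\<in>insert x F-{k}. u l) = u x * (\<Prod>l\<in>F-{k}. u l)" if "k \<in> F" for k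
    proof -
      have "insert x F - {k} = insert x (F - {k})" using that insert.hyps by auto
      thus ?thesis using insert.hyps by simp
    qed
    thus ?thesis by (simp add: sum_distrib_left)
  qed
  define P S where "P = (\<Prod>k\<in>F. u k)" and "S = (\<Sum>k\<in>F. \<Prod>l\<in>F-{k}. u l)"
  have "[(\<Prod>k\<in>insert x F. t + u k) = (t + u x) * (P + t * S)] (mod t\<^sup>2)"
    using insert by (auto simp: P_def S_def intro: cong_mult)
  also have "(t + u x) * (P + t * S) = (u x * P + t * (P + u x * S)) + t\<^sup>2 * S"
    by (simp add: algebra_simps power2_eq_square)
  also have "[\<dots> = u x * P + t * (P + u x * S)] (mod t\<^sup>2)"
    by (simp add: cong_def)
  finally show ?case using insert 1 by (simp add: P_def S_def)
qed simp

text \<open>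
  Here \<open>g\<close> is inversion modulo \<open>p ^ j\<close>. Doubling permutes the units, so the sum \<open>S\<close> of the inverse squares
  satisfies \<open>S = 4 S\<close>, and 3 is invertible because \<open>p \<ge> 5\<close>.
\<close>
lemma sum_inverse_squares_cong_0:
  fixes p :: nat and g :: "nat \<Rightarrow> int"
  assumes p: "prime p" "p \<ge> 5" and j: "j > 0"
  defines "U \<equiv> units_below p (p ^ j)"
  assumes g: "\<And>k. k \<in> U \<Longrightarrow> [int k * g k = 1] (mod int (p ^ j))"
  shows "[(\<Sum>k\<in>U. (g k)\<^sup>2) = 0] (mod int (p ^ j))"
proof -
  define N where "N = p ^ j"
  have N1: "N > 1" unfolding N_def using prime_gt_1_nat[OF p(1)] j by (rule one_less_power)
  have U_iff: "k \<in> U \<longleftrightarrow> k < N \<and> coprime k N" for k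
  proof -
    have "coprime k N \<longleftrightarrow> \<not> p dvd k" if "k > 0"
      using p j by (simp add: N_def coprime_commute[of k] prime_imp_coprime_nat
        coprime_power_left_iff) (meson coprime_absorb_left not_prime_unit prime_imp_coprime_nat)
    thus ?thesis using N1 by (cases "k = 0") (auto simp: U_def units_below_def N_def)
  qed
  have cop: "coprime 2 N" "coprime 3 N"
    using p j primes_coprime[of 2 p] primes_coprime[of 3 p] by (auto simp: N_def)
  define d where "d = (\<lambda>k. (2 * k) mod N)"
  have dU: "d ` U \<subseteq> U"
    using cop N1 by (auto simp: U_iff d_def coprime_mod_left_iff)
  have dinj: "inj_on d U"
  proof (rule inj_onI)
    fix x y assume xy: "x \<in> U" "y \<in> U" "d x = d y"
    hence "[2 * x = 2 * y] (mod N)" by (simp add: d_def cong_def)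
    hence "[x = y] (mod N)" using cop cong_mult_lcancel_nat by blast
    thus "x = y" using xy by (simp add: U_iff cong_def)
  qed
  have finU: "finite U" by (simp add: U_def units_below_def)
  have dim: "d ` U = U" using finU dU dinj endo_inj_surj by blast
  define S where "S = (\<Sum>k\<in>U. (g k)\<^sup>2)"
  have step: "[(g k)\<^sup>2 = 4 * (g (d k))\<^sup>2] (mod int N)" if k: "k \<in> U" for k
  proof -
    have dk: "d k \<in> U" using k dU by blast
    have "[int (d k) = 2 * int k] (mod int N)" by (simp add: d_def zmod_int)
    hence "[int (d k) * g (d k) = (2 * int k) * g (d k)] (mod int N)" by (rule cong_mult) simp
    hence "[2 * int k * g (d k) = 1] (mod int N)" using g[OF dk] cong_trans cong_sym
      unfolding N_def by blast
    hence "[g k * (2 * int k * g (d k)) = g k * 1] (mod int N)" by (intro cong_mult) auto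
    hence 1: "[int k * g k * (2 * g (d k)) = g k] (mod int N)" by (simp add: mult_ac)
    have "[int k * g k * (2 * g (d k)) = 1 * (2 * g (d k))] (mod int N)"
      using g[OF k] unfolding N_def by (intro cong_mult) auto
    hence "[g k = 2 * g (d k)] (mod int N)" using 1 by (simp add: cong_def)
    hence "[(g k)\<^sup>2 = (2 * g (d k))\<^sup>2] (mod int N)" by (rule cong_pow)
    thus ?thesis by (simp add: power_mult_distrib)
  qed
  have "[S = (\<Sum>k\<in>U. 4 * (g (d k))\<^sup>2)] (mod int N)"
    unfolding S_def by (intro cong_sum step)
  also have "(\<Sum>k\<in>U. 4 * (g (d k))\<^sup>2) = 4 * (\<Sum>k\<in>d ` U. (g k)\<^sup>2)"
    using dinj by (simp add: sum.reindex sum_distrib_left)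
  also have "\<dots> = 4 * S" by (simp add: dim S_def)
  finally have "int N dvd 3 * S" by (simp add: cong_iff_dvd_diff flip: minus_diff_eq[of S])
  moreover have "coprime (int N) 3" using cop(2) by (metis coprime_commute coprime_int_iff of_nat_numeral)
  ultimately have "int N dvd S" by (simp add: coprime_dvd_mult_right_iff)
  thus ?thesis by (simp add: S_def N_def cong_0_iff)
qed

text \<open>
  Let \<open>N = p ^ j\<close>. The ratio of the two coefficients is \<open>A / B\<close>, where \<open>A = \<Prod> (N + k)\<close> and \<open>B = \<Prod> k\<close>
  over the units \<open>k < N\<close>. Pairing \<open>k\<close> with \<open>N - k\<close> turns \<open>A\<^sup>2\<close> into the product of the
  \<open>2 N\<^sup>2 + k (N - k)\<close> and \<open>B\<^sup>2\<close> into that of the \<open>k (N - k)\<close>. To first order in \<open>N\<^sup>2\<close> they differ by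
  \<open>2 N\<^sup>2 B\<^sup>2 \<Sum> 1 / (k (N - k))\<close>, whose sum is minus the sum of the inverse squares modulo \<open>N\<close>
  and hence divisible by \<open>N\<close>. So \<open>N ^ 3\<close> divides \<open>(A + B) (A - B)\<close>, where \<open>A + B\<close> is prime to \<open>p\<close> as
  it is congruent to \<open>2 B\<close>.
\<close>
lemma half_central_prime_power_cong:
  fixes p :: nat
  assumes p: "prime p" "p \<ge> 5" and j: "j > 0"
  shows "int p ^ (3 * j) dvd int (half_central_binomial (p ^ j)) - int (half_central_binomial (p ^ (j - 1)))"
proof -
  define N where "N = p ^ j"
  define U where "U = units_below p N"
  have finU: "finite U" by (simp add: U_def units_below_def)
  have UD: "0 < k" "k < N" "\<not> p dvd k" if "k \<in> U" for k
    using that by (auto simp: U_def units_below_def)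
  have pN: "p dvd N" using j by (simp add: N_def)
  have cop: "coprime (int k) (int N)" if "k \<in> U" for k
    using UD(3)[OF that] p prime_imp_coprime_nat[of p k]
    by (simp add: N_def coprime_commute)
  define A B where "A = (\<Prod>k\<in>U. int N + int k)" and "B = (\<Prod>k\<in>U. int k)"
  define u where "u = (\<lambda>k. int k * (int N - int k))"
  have refl_prod: "(\<Prod>k\<in>U. f k) = (\<Prod>k\<in>U. f (N - k))" for f :: "nat \<Rightarrow> int"
    by (rule prod.reindex_bij_witness[where i = "\<lambda>k. N - k" and j = "\<lambda>k. N - k"])
       (use pN in \<open>auto simp: U_def units_below_def dvd_diff_nat dest: dvd_diffD1\<close>)
  have refl': "(\<Prod>k\<in>U. f (int k)) = (\<Prod>k\<in>U. f (int N - int k))" for f :: "int \<Rightarrow> int"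
    by (subst refl_prod) (auto intro!: prod.cong simp: of_nat_diff dest!: UD(2))
  have B2: "B\<^sup>2 = (\<Prod>k\<in>U. u k)"
  proof -
    have "B\<^sup>2 = B * (\<Prod>k\<in>U. int N - int k)"
      unfolding power2_eq_square B_def using refl'[of "\<lambda>x. x"] by simp
    thus ?thesis by (simp add: B_def u_def prod.distrib)
  qed
  have A2: "A\<^sup>2 = (\<Prod>k\<in>U. 2 * (int N)\<^sup>2 + u k)"
  proof -
    have "A\<^sup>2 = A * (\<Prod>k\<in>U. int N + (int N - int k))"
      unfolding power2_eq_square A_def using refl'[of "\<lambda>x. int N + x"] by simp
    also have "\<dots> = (\<Prod>k\<in>U. (int N + int k) * (int N + (int N - int k)))"
      by (simp add: A_def prod.distrib)
    also have "\<dots> = (\<Prod>k\<in>U. 2 * (int N)\<^sup>2 + u k)"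
      by (rule prod.cong) (auto simp: u_def algebra_simps power2_eq_square)
    finally show ?thesis .
  qed
  have "\<exists>x. [int k * x = 1] (mod int N)" if "k \<in> U" for k
    using cop[OF that] by (rule cong_solve_coprime_int)
  then obtain g where g: "\<And>k. k \<in> U \<Longrightarrow> [int k * g k = 1] (mod int N)" by metis
  have others: "[(\<Prod>l\<in>U-{k}. u l) = - (B\<^sup>2 * (g k)\<^sup>2)] (mod int N)" if k: "k \<in> U" for k
  proof -
    define Q where "Q = (\<Prod>l\<in>U-{k}. u l)"
    have "B\<^sup>2 = u k * Q" unfolding B2 Q_def using finU k by (rule prod.remove)
    hence "- (B\<^sup>2 * (g k)\<^sup>2) = - (int k * (int N - int k) * Q * (g k)\<^sup>2)"
      by (simp only: u_def)
    also have "\<dots> = (int k * g k)\<^sup>2 * Q - int N * (int k * (g k)\<^sup>2 * Q)"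
      by (simp add: algebra_simps power2_eq_square)
    also have "[\<dots> = 1\<^sup>2 * Q - 0] (mod int N)"
      using g[OF k] by (intro cong_diff cong_mult cong_pow) (auto simp: cong_def)
    finally show ?thesis by (simp add: Q_def cong_sym)
  qed
  have "[(\<Sum>k\<in>U. \<Prod>l\<in>U-{k}. u l) = (\<Sum>k\<in>U. - (B\<^sup>2 * (g k)\<^sup>2))] (mod int N)"
    by (intro cong_sum others)
  also have "(\<Sum>k\<in>U. - (B\<^sup>2 * (g k)\<^sup>2)) = - B\<^sup>2 * (\<Sum>k\<in>U. (g k)\<^sup>2)"
    by (simp add: sum_distrib_left sum_negf)
  also have "[\<dots> = - B\<^sup>2 * 0] (mod int N)"
    using sum_inverse_squares_cong_0[OF p j, of g] g unfolding U_def N_def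
    by (intro cong_mult) auto
  finally have "int N dvd (\<Sum>k\<in>U. \<Prod>l\<in>U-{k}. u l)" by (simp add: cong_0_iff)
  hence "(int N)\<^sup>2 * int N dvd 2 * (int N)\<^sup>2 * (\<Sum>k\<in>U. \<Prod>l\<in>U-{k}. u l)"
    by (intro mult_dvd_mono) auto
  hence N3: "int N ^ 3 dvd 2 * (int N)\<^sup>2 * (\<Sum>k\<in>U. \<Prod>l\<in>U-{k}. u l)"
    by (simp add: power3_eq_cube power2_eq_square)
  have "(2 * (int N)\<^sup>2)\<^sup>2 dvd A\<^sup>2 - (B\<^sup>2 + 2 * (int N)\<^sup>2 * (\<Sum>k\<in>U. \<Prod>l\<in>U-{k}. u l))"
    using prod_add_const_cong[OF finU, of "2 * (int N)\<^sup>2" u]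
    unfolding A2 B2 by (simp add: cong_iff_dvd_diff)
  moreover have "int N ^ 3 dvd (2 * (int N)\<^sup>2)\<^sup>2"
    by (simp add: power_mult_distrib flip: power_mult) (simp add: le_imp_power_dvd)
  ultimately have "int N ^ 3 dvd A\<^sup>2 - (B\<^sup>2 + 2 * (int N)\<^sup>2 * (\<Sum>k\<in>U. \<Prod>l\<in>U-{k}. u l))"
    by (rule dvd_trans[rotated])
  from dvd_add[OF this N3] have "int N ^ 3 dvd A\<^sup>2 - B\<^sup>2" by simp
  hence AB: "int N ^ 3 dvd (A + B) * (A - B)" by (simp add: power2_eq_square algebra_simps)
  have pr: "prime (int p)" using p by simp
  have pB: "\<not> int p dvd B"
    unfolding B_def using finU pr UD(3) by (simp add: prime_dvd_prod_iff)
  have "[A = B] (mod int p)"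
    unfolding A_def B_def by (rule cong_prod) (use pN in \<open>simp add: cong_iff_dvd_diff\<close>)
  hence "int p dvd A - B" by (simp add: cong_iff_dvd_diff)
  have "\<not> int p dvd A + B"
  proof
    assume "int p dvd A + B"
    hence "int p dvd (A + B) - (A - B)" using \<open>int p dvd A - B\<close> by (rule dvd_diff)
    hence "int p dvd 2 * B" by simp
    hence "int p dvd 2" using pr pB prime_dvd_multD by blast
    thus False using p by (auto dest: zdvd_imp_le)
  qed
  hence "coprime (int N ^ 3) (A + B)"
    using pr j by (simp add: N_def prime_imp_coprime)
  with AB have AB: "int N ^ 3 dvd A - B" by (simp add: coprime_dvd_mult_right_iff)
  define M where "M = p ^ (j - 1)"
  have NM: "N = p * M" using j by (simp add: N_def M_def flip: power_Suc)
  have "half_central_binomial M * (\<Prod>k\<in>U. N + k) = half_central_binomial N * (\<Prod>k\<in>U. k)"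
    using half_central_ratio[of p M] p unfolding U_def NM by (simp add: M_def prime_gt_0_nat)
  hence "int (half_central_binomial M * (\<Prod>k\<in>U. N + k)) = int (half_central_binomial N * (\<Prod>k\<in>U. k))" by simp
  hence "int (half_central_binomial M) * A = int (half_central_binomial N) * B" by (simp add: A_def B_def)
  hence "(int (half_central_binomial N) - int (half_central_binomial M)) * B = int (half_central_binomial M) * (A - B)"
    by (simp add: algebra_simps)
  hence "int N ^ 3 dvd B * (int (half_central_binomial N) - int (half_central_binomial M))" using AB by (simp add: mult.commute)
  moreover have "coprime (int N ^ 3) B" using pr j pB by (simp add: N_def prime_imp_coprime)
  ultimately have "int N ^ 3 dvd int (half_central_binomial N) - int (half_central_binomial M)"
    by (simp add: coprime_dvd_mult_right_iff)
  moreover have "int N ^ 3 = int p ^ (3 * j)" by (simp add: N_def mult.commute flip: power_mult)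
  ultimately show ?thesis by (simp add: N_def M_def)
qed

section \<open>Reduction modulo \<open>p\<^sup>4\<close>\<close>

text \<open>
  Writing each summand as a telescoping sum and exchanging the order of summation gathers
  the differences of consecutive coefficients, weighted by the numbers of \<open>x\<close> with \<open>e x \<le> i\<close>. Only the
  last difference, of weight \<open>p ^ m\<close>, survives modulo \<open>p ^ (m + 4)\<close>.
\<close>
lemma weighted_half_central_sum_cong:
  fixes p m N :: nat and e :: "'a \<Rightarrow> nat"
  assumes p: "prime p" "p \<ge> 5" and m: "m > 0" and fin: "finite A" and card: "card A = p ^ m"
    and dvd: "\<And>i. i \<le> m \<Longrightarrow> p ^ i dvd card {x \<in> A. e x \<le> i}"
    and top: "\<And>x. x \<in> A \<Longrightarrow> e x < m"
    and N: "p ^ m * N = (\<Sum>x\<in>A. half_central_binomial (p ^ (m - e x)))"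
  shows "[N = half_central_binomial p] (mod p ^ 4)"
proof -
  define c where "c = (\<lambda>j. int (half_central_binomial (p ^ j)))"
  define D where "D = (\<lambda>i. c (m - i) - c (m - Suc i))"
  have c0: "c 0 = 1" by (simp add: c_def half_central_binomial_def)
  have tele: "c (m - k) = 1 + (\<Sum>i<m. if k \<le> i then D i else 0)" if "k \<le> m" for k
  proof -
    have "(\<Sum>i<m. if k \<le> i then D i else 0) = (\<Sum>i\<in>{k..<m}. D i)"
      by (rule sum.mono_neutral_cong_right) auto
    also have "\<dots> = c (m - k) - c (m - m)"
      using sum_Suc_diff'[OF that, of "\<lambda>i. - c (m - i)"] by (simp add: D_def)
    finally show ?thesis by (simp add: c0)
  qed
  have "int (p ^ m * N) = (\<Sum>x\<in>A. c (m - e x))" unfolding N by (simp add: c_def)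
  also have "\<dots> = (\<Sum>x\<in>A. 1 + (\<Sum>i<m. if e x \<le> i then D i else 0))"
    using tele top by (simp add: less_imp_le)
  also have "\<dots> = int (p ^ m) + (\<Sum>x\<in>A. \<Sum>i<m. if e x \<le> i then D i else 0)"
    by (simp add: sum.distrib card)
  also have "(\<Sum>x\<in>A. \<Sum>i<m. if e x \<le> i then D i else 0) = (\<Sum>i<m. \<Sum>x\<in>A. if e x \<le> i then D i else 0)"
    by (rule sum.swap)
  also have "\<dots> = (\<Sum>i<m. int (card {x \<in> A. e x \<le> i}) * D i)"
    using fin by (simp add: sum.If_cases Int_def)
  also have "\<dots> = (\<Sum>i<m-1. int (card {x \<in> A. e x \<le> i}) * D i) + int (p ^ m) * (c 1 - c 0)"
  proof -
    have "{x \<in> A. e x \<le> m - 1} = A" using top m by force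
    moreover have "{..<m} = insert (m - 1) {..<m - 1}" using m by auto
    moreover have "D (m - 1) = c 1 - c 0" using m by (simp add: D_def)
    ultimately show ?thesis using card by simp
  qed
  finally have "int p ^ m * (int N - c 1) = (\<Sum>i<m-1. int (card {x \<in> A. e x \<le> i}) * D i)"
    by (simp add: c0 algebra_simps)
  moreover have "int p ^ (m + 4) dvd int (card {x \<in> A. e x \<le> i}) * D i" if i: "i < m - 1" for i
  proof -
    have "int p ^ (3 * (m - i)) dvd D i"
      using half_central_prime_power_cong[OF p, of "m - i"] i by (simp add: D_def c_def)
    moreover have "int p ^ i dvd int (card {x \<in> A. e x \<le> i})"
      using dvd[of i] i by (metis less_imp_le_nat less_diff_conv add_lessD1 of_nat_dvd_iff of_nat_power)
    ultimately have "int p ^ i * int p ^ (3 * (m - i)) dvd int (card {x \<in> A. e x \<le> i}) * D i"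
      by (rule mult_dvd_mono[rotated])
    moreover have "m + 4 \<le> i + 3 * (m - i)" using i by linarith
    hence "int p ^ (m + 4) dvd int p ^ i * int p ^ (3 * (m - i))"
      by (simp add: le_imp_power_dvd flip: power_add)
    ultimately show ?thesis using dvd_trans by blast
  qed
  ultimately have "int p ^ (m + 4) dvd int p ^ m * (int N - c 1)" by (auto intro: dvd_sum)
  hence "int p ^ 4 dvd int N - c 1" using p by (simp add: power_add)
  hence "[int N = int (half_central_binomial p)] (mod int (p ^ 4))" by (simp add: c_def cong_iff_dvd_diff)
  thus ?thesis unfolding cong_int_iff .
qed

section \<open>Products of cyclic groups\<close>

lemma comm_group_product_group:
  assumes "\<And>i. i \<in> I \<Longrightarrow> comm_group (H i)"
  shows "comm_group (product_group I H)"
proof (rule group.group_comm_groupI)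
  show "group (product_group I H)" using assms by (simp add: comm_group_def)
  fix x y assume "x \<in> carrier (product_group I H)" "y \<in> carrier (product_group I H)"
  thus "x \<otimes>\<^bsub>product_group I H\<^esub> y = y \<otimes>\<^bsub>product_group I H\<^esub> x"
    using assms by (auto simp: PiE_iff intro!: restrict_ext comm_monoid.m_comm comm_group.axioms(1))
qed

lemma nat_pow_product_group:
  assumes "x \<in> carrier (product_group I H)"
  shows "x [^]\<^bsub>product_group I H\<^esub> (n :: nat) = (\<lambda>i\<in>I. x i [^]\<^bsub>H i\<^esub> n)"
  by (induction n) (auto simp: restrict_def)

lemma card_annihilated_integers:
  fixes p :: nat
  assumes "p > 0"
  shows "card {x \<in> {0..<int (p ^ k)}. (int (p ^ i) * x) mod int (p ^ k) = 0} = p ^ min i k"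
proof (cases "k \<le> i")
  case True
  hence "int (p ^ k) dvd int (p ^ i)" by (simp add: le_imp_power_dvd)
  hence "{x \<in> {0..<int (p ^ k)}. (int (p ^ i) * x) mod int (p ^ k) = 0} = {0..<int (p ^ k)}"
    by (auto intro: dvd_mult2)
  moreover have "card {0..<int (p ^ k)} = p ^ k" by (simp del: of_nat_power)
  ultimately show ?thesis using True by (simp add: min_def)
next
  case False
  define q r where "q = int (p ^ i)" and "r = int (p ^ (k - i))"
  have pk: "int (p ^ k) = q * r" using False by (simp add: q_def r_def flip: power_add)
  have qr: "q > 0" "r > 0" using assms by (simp_all add: q_def r_def)
  have "{x \<in> {0..<q * r}. (q * x) mod (q * r) = 0} = (\<lambda>y. r * y) ` {0..<q}"
  proof (intro equalityI subsetI)
    fix x assume x: "x \<in> {x \<in> {0..<q * r}. (q * x) mod (q * r) = 0}"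
    hence "q * r dvd q * x" by auto
    hence "r dvd x" using qr by simp
    then obtain y where y: "x = r * y" by blast
    hence "0 \<le> r * y" "r * y < r * q" using x by (auto simp: mult.commute)
    hence "0 \<le> y" "y < q" using qr by (auto simp: zero_le_mult_iff)
    thus "x \<in> (\<lambda>y. r * y) ` {0..<q}" using y by auto
  next
    fix x assume "x \<in> (\<lambda>y. r * y) ` {0..<q}"
    thus "x \<in> {x \<in> {0..<q * r}. (q * x) mod (q * r) = 0}" using qr
      by (auto simp: mult.commute[of q r] mult.left_commute[of q r])
  qed
  moreover have "inj_on (\<lambda>y. r * y) {0..<q}" using qr by (auto simp: inj_on_def)
  ultimately show ?thesis using False unfolding pk by (simp add: card_image q_def del: of_nat_power)
qed

definition root_char :: "nat \<Rightarrow> int \<Rightarrow> complex"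
  where "root_char n t = cis (2 * pi * (of_int t / of_nat n))"

lemma root_char_add: "root_char n (s + t) = root_char n s * root_char n t"
  by (simp add: root_char_def cis_mult add_divide_distrib algebra_simps)

lemma root_char_eq_1_iff:
  assumes "n > 0"
  shows "root_char n t = 1 \<longleftrightarrow> int n dvd t"
proof
  assume "int n dvd t"
  then obtain k where "t = int n * k" by blast
  thus "root_char n t = 1" using assms by (simp add: root_char_def)
next
  assume "root_char n t = 1"
  hence "cos (2 * pi * (of_int t / of_nat n)) = 1" by (simp add: root_char_def complex_eq_iff)
  then obtain k :: int where "2 * pi * (of_int t / of_nat n) = of_int k * 2 * pi"
    unfolding cos_one_2pi_int by blast
  hence "2 * pi * (of_int t / of_nat n) = 2 * pi * of_int k" by (simp only: mult_ac)
  hence "of_int t / real n = of_int k" by (subst (asm) mult_left_cancel) simp_all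
  hence "real_of_int t = real_of_int (int n * k)" using assms by (simp add: field_simps)
  hence "t = int n * k" by linarith
  thus "int n dvd t" by simp
qed

lemma root_char_mult_mod:
  assumes "n > 0"
  shows "root_char n (a * (t mod int n)) = root_char n (a * t)"
proof -
  have "a * t = a * (t mod int n) + int n * (a * (t div int n))"
    by (metis distrib_left mod_mult_div_eq mult.left_commute)
  thus ?thesis using root_char_eq_1_iff[OF assms, of "int n * (a * (t div int n))"]
    by (simp add: root_char_add)
qed

lemma cyclic_single_factor:
  "cyclic_group (product_group {..<1::nat} (\<lambda>i. integer_mod_group (f i)))"
proof -
  let ?H = "integer_mod_group (f 0)" and ?P = "product_group {..<1::nat} (\<lambda>i. integer_mod_group (f i))"
  have "cyclic_group ?H"
  proof (cases "f 0 = 1")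
    case True
    thus ?thesis by (simp add: trivial_imp_cyclic_group trivial_integer_mod_group)
  next
    case False
    have "carrier ?H = range (\<lambda>n::int. 1 [^]\<^bsub>?H\<^esub> n)"
    proof (cases "f 0 = 0")
      case True
      thus ?thesis by (auto simp: int_pow_integer_mod_group carrier_integer_mod_group)
    next
      case False
      have "x \<in> range (\<lambda>n. n mod int (f 0))" if "x \<in> {0..<int (f 0)}" for x
        using that by (intro range_eqI[of _ _ x]) auto
      thus ?thesis using False by (auto simp: int_pow_integer_mod_group carrier_integer_mod_group)
    qed
    thus ?thesis using False group.cyclic_group[OF group_integer_mod_group] by fastforce
  qed
  moreover have "(\<lambda>x. \<lambda>i\<in>{..<1::nat}. x) \<in> epi ?H ?P"
  proof -
    have "(\<lambda>x. \<lambda>i\<in>{..<1::nat}. x) ` carrier ?H = carrier ?P"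
    proof (intro equalityI subsetI)
      fix z assume "z \<in> carrier ?P"
      thus "z \<in> (\<lambda>x. \<lambda>i\<in>{..<1::nat}. x) ` carrier ?H"
        by (intro image_eqI[of _ _ "z 0"]) (auto simp: PiE_iff extensional_def fun_eq_iff)
    qed (auto split: if_splits)
    moreover have "(\<lambda>x. \<lambda>i\<in>{..<1::nat}. x) \<in> hom ?H ?P"
      by (auto simp: hom_def fun_eq_iff split: if_splits)
    ultimately show ?thesis by (simp add: epi_def)
  qed
  ultimately show ?thesis
    using group.cyclic_group_epimorphic_image[OF group_integer_mod_group] by (metis product_group group_integer_mod_group)
qed

theorem theorem1p5:
  fixes p n :: nat and ks :: "nat list"
  assumes "prime p" and "p \<ge> 5"
    and "n > 0" and "is_partition ks n"
    and "\<not> cyclic_group (abelian_p_group p ks)"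
  shows "[num_monomials (group_permanent (abelian_p_group p ks)) = (2 * p - 1) choose (p - 1)] (mod p ^ 4)"
proof -
  define G where "G = abelian_p_group p ks"
  define r where "r = length ks"
  define q where "q = (\<lambda>i. p ^ (ks ! i))"
  have G_def': "G = product_group {..<r} (\<lambda>i. integer_mod_group (q i))"
    by (simp add: G_def abelian_p_group_def r_def q_def)
  have p0: "p > 0" using assms(1) by (simp add: prime_gt_0_nat)
  have q0: "q i > 0" for i using p0 by (simp add: q_def)
  have ks1: "ks ! i \<ge> 1" if "i < r" for i
    using that assms(4) by (auto simp: is_partition_def r_def)
  have sum_ks: "(\<Sum>i<r. ks ! i) = n"
    using assms(4) by (simp add: is_partition_def r_def sum_list_sum_nth atLeast0LessThan)
  have "r \<noteq> 0" using sum_ks assms(3) by (cases "r = 0") simp_all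
  moreover have "r \<noteq> 1"
    using cyclic_single_factor[of q] assms(5) unfolding G_def[symmetric] G_def' by auto
  \<comment> \<open>noncyclicity: with at least two factors, every exponent is less than \<open>n\<close>\<close>
  ultimately have r2: "r \<ge> 2" by linarith
  have ks_less: "ks ! i < n" if i: "i < r" for i
  proof -
    define j where "j = (if i = 0 then 1 else 0 :: nat)"
    have j: "j < r" "j \<noteq> i" using r2 by (auto simp: j_def)
    have "ks ! i + ks ! j = (\<Sum>l\<in>{i, j}. ks ! l)" using j by simp
    also have "\<dots> \<le> (\<Sum>l<r. ks ! l)" by (rule sum_mono2) (use i j in auto)
    finally show ?thesis using ks1[OF j(1)] sum_ks by simp
  qed
  interpret comm_group G unfolding G_def' by (rule comm_group_product_group) simp
  have "carrier (integer_mod_group (q i)) = {0..<int (q i)}" for i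
    using q0[of i] by (simp add: carrier_integer_mod_group)
  hence carr: "carrier G = (\<Pi>\<^sub>E i\<in>{..<r}. {0..<int (q i)})"
    by (simp add: G_def')
  have fin: "finite (carrier G)" unfolding carr by (rule finite_PiE) auto
  have order: "Coset.order G = p ^ n"
  proof -
    have "card (carrier G) = (\<Prod>i<r. q i)" unfolding carr by (simp add: card_PiE)
    thus ?thesis by (simp add: Coset.order_def q_def sum_ks flip: power_sum)
  qed
  have mult: "(x \<otimes>\<^bsub>G\<^esub> y) i = (x i + y i) mod int (q i)" if "i < r" for x y i
    using that by (simp add: G_def')
  have one: "\<one>\<^bsub>G\<^esub> = (\<lambda>i\<in>{..<r}. 0)" by (simp add: G_def')
  \<comment> \<open>the pairing of the group with itself that multiplies the standard pairings of the cyclic factors\<close>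
  define \<chi> where "\<chi> = (\<lambda>a x :: nat \<Rightarrow> int. \<Prod>i<r. root_char (q i) (a i * x i))"
  have hom: "\<chi> a (x \<otimes>\<^bsub>G\<^esub> y) = \<chi> a x * \<chi> a y" for a x y
    unfolding \<chi>_def prod.distrib[symmetric]
    by (rule prod.cong) (simp_all add: mult root_char_mult_mod[OF q0] distrib_left root_char_add)
  have sym: "\<chi> a x = \<chi> x a" for a x by (simp add: \<chi>_def mult.commute)
  have nz: "\<chi> a x \<noteq> 0" for a x by (simp add: \<chi>_def root_char_def)
  have nondeg: "\<exists>a\<in>carrier G. \<chi> a x \<noteq> 1" if x: "x \<in> carrier G" "x \<noteq> \<one>\<^bsub>G\<^esub>" for x
  proof -
    obtain i where i: "i < r" "x i \<noteq> 0"
      using x by (auto simp: carr one PiE_iff extensional_def fun_eq_iff split: if_splits)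
    have xi: "0 \<le> x i" "x i < int (q i)" using x(1) i by (auto simp: carr PiE_iff)
    \<comment> \<open>the generator of the \<open>i\<close>-th factor detects the component \<open>x i\<close>\<close>
    define a where "a = (\<lambda>j\<in>{..<r}. if j = i then 1 else 0 :: int)"
    have "q j > 1" if "j < r" for j
      unfolding q_def using ks1[OF that] prime_gt_1_nat[OF assms(1)] by (intro one_less_power) auto
    hence "a \<in> carrier G" using q0 by (auto simp: carr a_def)
    moreover have "\<chi> a x = (\<Prod>j<r. if j = i then root_char (q i) (x i) else 1)"
      unfolding \<chi>_def by (rule prod.cong) (auto simp: a_def root_char_def)
    hence "\<chi> a x = root_char (q i) (x i)" using i by simp
    moreover have "\<not> int (q i) dvd x i" using xi i by (auto dest: zdvd_imp_le)
    ultimately show ?thesis by (intro bexI[of _ a]) (simp_all add: root_char_eq_1_iff[OF q0])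
  qed
  define e where "e = (\<lambda>a. LEAST i. a [^]\<^bsub>G\<^esub> (p ^ i) = \<one>\<^bsub>G\<^esub>)"
  have ann_iff: "a [^]\<^bsub>G\<^esub> (p ^ i) = \<one>\<^bsub>G\<^esub> \<longleftrightarrow> (\<forall>j<r. (int (p ^ i) * a j) mod int (q j) = 0)"
    if "a \<in> carrier G" for a i
    using that nat_pow_product_group[of a "{..<r}" "\<lambda>i. integer_mod_group (q i)"]
    unfolding one by (auto simp: G_def' fun_eq_iff)
  have e_le_iff: "e a \<le> i \<longleftrightarrow> a [^]\<^bsub>G\<^esub> (p ^ i) = \<one>\<^bsub>G\<^esub>" if a: "a \<in> carrier G" for a i
  proof
    assume le: "e a \<le> i"
    have "a [^]\<^bsub>G\<^esub> (p ^ n) = \<one>\<^bsub>G\<^esub>" using pow_order_eq_1[OF a] order by simp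
    hence "a [^]\<^bsub>G\<^esub> (p ^ e a) = \<one>\<^bsub>G\<^esub>" unfolding e_def by (rule LeastI)
    moreover have "p ^ i = p ^ e a * p ^ (i - e a)" using le by (simp flip: power_add)
    ultimately show "a [^]\<^bsub>G\<^esub> (p ^ i) = \<one>\<^bsub>G\<^esub>" using a by (simp flip: nat_pow_pow)
  qed (simp add: e_def Least_le)
  have card_e: "card {a \<in> carrier G. e a \<le> i} = (\<Prod>j<r. p ^ min i (ks ! j))" for i
  proof -
    have "{a \<in> carrier G. e a \<le> i}
        = {a \<in> carrier G. \<forall>j<r. (int (p ^ i) * a j) mod int (q j) = 0}"
      using e_le_iff ann_iff by blast
    also have "\<dots> = (\<Pi>\<^sub>E j\<in>{..<r}. {x \<in> {0..<int (p ^ (ks ! j))}. (int (p ^ i) * x) mod int (p ^ (ks ! j)) = 0})"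
      unfolding carr q_def PiE_def Pi_def by blast
    finally show ?thesis using card_annihilated_integers[OF p0] by (simp add: card_PiE)
  qed
  have pr_dvd: "p ^ i dvd card {a \<in> carrier G. e a \<le> i}" if "i \<le> n" for i
  proof (cases "\<exists>j<r. i < ks ! j")
    case True
    then obtain j where j: "j < r" "i < ks ! j" by blast
    hence "p ^ min i (ks ! j) dvd (\<Prod>j<r. p ^ min i (ks ! j))" by (intro dvd_prodI) auto
    thus ?thesis using j unfolding card_e by simp
  next
    case False
    hence "(\<Prod>j<r. p ^ min i (ks ! j)) = (\<Prod>j<r. p ^ (ks ! j))"
      by (intro prod.cong) (auto simp: min_def)
    also have "\<dots> = p ^ n" by (simp add: sum_ks flip: power_sum)
    finally show ?thesis using that unfolding card_e by (simp add: le_imp_power_dvd)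
  qed
  have e_less: "e a < n" if a: "a \<in> carrier G" for a
  proof -
    have "int (q j) dvd int (p ^ (n - 1)) * a j" if "j < r" for j
      using ks_less[OF that] unfolding q_def by (intro dvd_mult2) (simp add: le_imp_power_dvd)
    hence "e a \<le> n - 1" using e_le_iff[OF a] ann_iff[OF a] by auto
    thus ?thesis using assms(3) by simp
  qed
  have "p ^ n * num_monomials (group_permanent G) = (\<Sum>a\<in>carrier G. half_central_binomial (p ^ (n - e a)))"
    unfolding num_monomials_group_permanent[OF fin] e_def
    by (rule count_one_product_multisets[OF fin assms(1) order hom sym nz nondeg])
  hence "[num_monomials (group_permanent G) = half_central_binomial p] (mod p ^ 4)"
    using fin order e_less pr_dvd
    by (intro weighted_half_central_sum_cong[OF assms(1-3), of "carrier G" e])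
       (auto simp: Coset.order_def intro: less_imp_le)
  thus ?thesis by (simp add: G_def half_central_binomial_def)
qed

end
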